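(* Let $R$ be a ring with identity and let $\varphi\in\mathrm{End}_R(M)$ be an $R$-endomorphism of a finitely generated semisimple left $R$-module ${}_RM$. Then there exist $R$-submodules $W_1$, $W_2$ and $V$ of $M$ such that, with $W=W_1\oplus W_2$ and $M=V\oplus W$ direct sums, one has $\ker(\varphi)\subseteq W$, $\varphi(W)=W_2$, $\varphi(V)=V$, $\dim_R(W_1)=\dim_R(\ker(\varphi))$, the restriction $\varphi\upharpoonright W\in\mathrm{End}_R(W)$ is nilpotent, and for the zero-level centralizer of $\varphi$ there is a ring isomorphism $\mathrm{Cen}_0(\varphi)\cong T$, where $$T=\{\theta\in\mathrm{End}_R(W)\mid\theta(W_1)\subseteq\ker(\varphi)\text{ and }\theta(W_2)=\{0\}\}=\mathrm{Cen}_0(\varphi\upharpoonright W)$$ is a left ideal of $$\mathrm{End}_R^{\ast}(W)=\{\alpha\in\mathrm{End}_R(W)\mid\alpha(\ker(\varphi))\subseteq\ker(\varphi)\}$$ and a right ideal of $$\mathrm{End}_R^{\ast\ast}(W)=\{\alpha\in\mathrm{End}_R(W)\mid\alpha(W_1+\ker(\varphi))\subseteq W_1+\ker(\varphi)\text{ and }\alpha(W_2)\subseteq W_2\}.$$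
   Context: For an endomorphism $\varphi$ of a module $N$, the zero-level centralizer is $\mathrm{Cen}_0(\varphi)=\{\psi\in\mathrm{End}_R(N)\mid\psi\circ\varphi=\varphi\circ\psi=0\}$, a ring (not necessarily with identity) under composition. In particular $\mathrm{Cen}_0(\varphi\upharpoonright W)$ is taken inside $\mathrm{End}_R(W)$. For a finitely generated semisimple module $N$, $\dim_R(N)$ is the number of summands in a decomposition of $N$ into a direct sum of simple submodules (its composition length). *)

theory Defs
  imports "HOL-Algebra.Algebra"
begin

text \<open>The library locale \<^locale>\<open>module\<close> requires a commutative ring of scalars. The locale below has
  the same axioms over an arbitrary ring with identity. As in the library, the fields
  \<^const>\<open>monoid.mult\<close> and \<^const>\<open>one\<close> of the module record play no role, and a submodule \<open>N\<close> is made
  into a module as \<open>M\<lparr>carrier := N\<rparr>\<close>. The library's \<^locale>\<open>submodule\<close> makes no commutativity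
  assumption.\<close>

locale left_module = R?: ring R + M?: abelian_group M
  for R :: "('r, 'p) ring_scheme" (structure) and M :: "('r, 'm, 'q) module_scheme" (structure) +
  assumes smult_closed [simp, intro]:
      "\<lbrakk>a \<in> carrier R; x \<in> carrier M\<rbrakk> \<Longrightarrow> a \<odot>\<^bsub>M\<^esub> x \<in> carrier M"
    and smult_l_distr:
      "\<lbrakk>a \<in> carrier R; b \<in> carrier R; x \<in> carrier M\<rbrakk> \<Longrightarrow>
        (a \<oplus> b) \<odot>\<^bsub>M\<^esub> x = a \<odot>\<^bsub>M\<^esub> x \<oplus>\<^bsub>M\<^esub> b \<odot>\<^bsub>M\<^esub> x"
    and smult_r_distr:
      "\<lbrakk>a \<in> carrier R; x \<in> carrier M; y \<in> carrier M\<rbrakk> \<Longrightarrow>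
        a \<odot>\<^bsub>M\<^esub> (x \<oplus>\<^bsub>M\<^esub> y) = a \<odot>\<^bsub>M\<^esub> x \<oplus>\<^bsub>M\<^esub> a \<odot>\<^bsub>M\<^esub> y"
    and smult_assoc1:
      "\<lbrakk>a \<in> carrier R; b \<in> carrier R; x \<in> carrier M\<rbrakk> \<Longrightarrow>
        (a \<otimes> b) \<odot>\<^bsub>M\<^esub> x = a \<odot>\<^bsub>M\<^esub> (b \<odot>\<^bsub>M\<^esub> x)"
    and smult_one [simp]:
      "x \<in> carrier M \<Longrightarrow> \<one> \<odot>\<^bsub>M\<^esub> x = x"

definition module_span ::
    "('r, 'p) ring_scheme \<Rightarrow> ('r, 'm, 'q) module_scheme \<Rightarrow> 'm set \<Rightarrow> 'm set" where
  "module_span R M A = \<Inter>{N. submodule N R M \<and> A \<subseteq> N}"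

definition finitely_generated_module ::
    "('r, 'p) ring_scheme \<Rightarrow> ('r, 'm, 'q) module_scheme \<Rightarrow> bool" where
  "finitely_generated_module R M \<longleftrightarrow>
     (\<exists>A. finite A \<and> A \<subseteq> carrier M \<and> module_span R M A = carrier M)"

definition simple_module ::
    "('r, 'p) ring_scheme \<Rightarrow> ('r, 'm, 'q) module_scheme \<Rightarrow> bool" where
  "simple_module R M \<longleftrightarrow>
     carrier M \<noteq> {\<zero>\<^bsub>M\<^esub>} \<and>
     (\<forall>N. submodule N R M \<longrightarrow> N = {\<zero>\<^bsub>M\<^esub>} \<or> N = carrier M)"

text \<open>\<open>M\<close> is the internal direct sum of the simple submodules in \<open>\<S>\<close>. Indexing by a set of
  submodules loses nothing: simple submodules are nonzero, so the summands of an internal direct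
  sum are pairwise distinct.\<close>

definition simple_decomposition ::
    "('r, 'p) ring_scheme \<Rightarrow> ('r, 'm, 'q) module_scheme \<Rightarrow> 'm set set \<Rightarrow> bool" where
  "simple_decomposition R M \<S> \<longleftrightarrow>
     (\<forall>S\<in>\<S>. submodule S R M \<and> simple_module R (M\<lparr>carrier := S\<rparr>)) \<and>
     (\<forall>S\<in>\<S>. S \<inter> module_span R M (\<Union>(\<S> - {S})) = {\<zero>\<^bsub>M\<^esub>}) \<and>
     module_span R M (\<Union>\<S>) = carrier M"

definition semisimple_module ::
    "('r, 'p) ring_scheme \<Rightarrow> ('r, 'm, 'q) module_scheme \<Rightarrow> bool" where
  "semisimple_module R M \<longleftrightarrow> (\<exists>\<S>. simple_decomposition R M \<S>)"

text \<open>Meaningful for finitely generated semisimple modules only, where the number of summands is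
  finite and, by Jordan--Hoelder, does not depend on the decomposition.\<close>

definition semisimple_dim ::
    "('r, 'p) ring_scheme \<Rightarrow> ('r, 'm, 'q) module_scheme \<Rightarrow> nat" where
  "semisimple_dim R M = (THE n. \<exists>\<S>. finite \<S> \<and> simple_decomposition R M \<S> \<and> card \<S> = n)"

definition direct_sum_of ::
    "('r, 'p) ring_scheme \<Rightarrow> ('r, 'm, 'q) module_scheme \<Rightarrow> 'm set \<Rightarrow> 'm set \<Rightarrow> 'm set \<Rightarrow> bool" where
  "direct_sum_of R M N A B \<longleftrightarrow>
     submodule A R M \<and> submodule B R M \<and> N = A <+>\<^bsub>M\<^esub> B \<and> A \<inter> B = {\<zero>\<^bsub>M\<^esub>}"

text \<open>Endomorphisms are extensional functions (\<^const>\<open>undefined\<close> off the carrier), so that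
  equality of elements of the ring is equality of maps on \<open>carrier M\<close>.\<close>

definition module_End ::
    "('r, 'p) ring_scheme \<Rightarrow> ('r, 'm, 'q) module_scheme \<Rightarrow> ('m \<Rightarrow> 'm) ring" where
  "module_End R M =
     \<lparr>carrier = {f \<in> carrier M \<rightarrow>\<^sub>E carrier M.
        (\<forall>x\<in>carrier M. \<forall>y\<in>carrier M. f (x \<oplus>\<^bsub>M\<^esub> y) = f x \<oplus>\<^bsub>M\<^esub> f y) \<and>
        (\<forall>a\<in>carrier R. \<forall>x\<in>carrier M. f (a \<odot>\<^bsub>M\<^esub> x) = a \<odot>\<^bsub>M\<^esub> f x)},
      monoid.mult = (\<lambda>f g. compose (carrier M) f g),
      one = (\<lambda>x\<in>carrier M. x),
      ring.zero = (\<lambda>x\<in>carrier M. \<zero>\<^bsub>M\<^esub>),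
      add = (\<lambda>f g. \<lambda>x\<in>carrier M. f x \<oplus>\<^bsub>M\<^esub> g x)\<rparr>"

definition Cen0 ::
    "('r, 'p) ring_scheme \<Rightarrow> ('r, 'm, 'q) module_scheme \<Rightarrow> ('m \<Rightarrow> 'm) \<Rightarrow> ('m \<Rightarrow> 'm) set" where
  "Cen0 R M \<phi> =
     {\<psi> \<in> carrier (module_End R M).
        \<psi> \<otimes>\<^bsub>module_End R M\<^esub> \<phi> = \<zero>\<^bsub>module_End R M\<^esub> \<and>
        \<phi> \<otimes>\<^bsub>module_End R M\<^esub> \<psi> = \<zero>\<^bsub>module_End R M\<^esub>}"

text \<open>Rings not necessarily with identity; the field \<^const>\<open>one\<close> is ignored.\<close>

locale nonunital_ring = abelian_group A for A (structure) +
  assumes m_closed: "\<lbrakk>x \<in> carrier A; y \<in> carrier A\<rbrakk> \<Longrightarrow> x \<otimes> y \<in> carrier A"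
    and m_assoc: "\<lbrakk>x \<in> carrier A; y \<in> carrier A; z \<in> carrier A\<rbrakk> \<Longrightarrow>
      (x \<otimes> y) \<otimes> z = x \<otimes> (y \<otimes> z)"
    and l_distr: "\<lbrakk>x \<in> carrier A; y \<in> carrier A; z \<in> carrier A\<rbrakk> \<Longrightarrow>
      (x \<oplus> y) \<otimes> z = x \<otimes> z \<oplus> y \<otimes> z"
    and r_distr: "\<lbrakk>x \<in> carrier A; y \<in> carrier A; z \<in> carrier A\<rbrakk> \<Longrightarrow>
      z \<otimes> (x \<oplus> y) = z \<otimes> x \<oplus> z \<otimes> y"

definition nonunital_ring_isomorphic ::
    "('a, 'p) ring_scheme \<Rightarrow> ('b, 'q) ring_scheme \<Rightarrow> bool" where
  "nonunital_ring_isomorphic A B \<longleftrightarrow>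
     nonunital_ring A \<and> nonunital_ring B \<and>
     (\<exists>h. bij_betw h (carrier A) (carrier B) \<and>
       (\<forall>x\<in>carrier A. \<forall>y\<in>carrier A.
          h (x \<oplus>\<^bsub>A\<^esub> y) = h x \<oplus>\<^bsub>B\<^esub> h y \<and> h (x \<otimes>\<^bsub>A\<^esub> y) = h x \<otimes>\<^bsub>B\<^esub> h y))"

text \<open>One-sided versions of the library's \<^locale>\<open>ideal\<close>.\<close>

locale left_ideal = additive_subgroup I A + ring A for I and A (structure) +
  assumes I_l_closed: "\<lbrakk>a \<in> I; x \<in> carrier A\<rbrakk> \<Longrightarrow> x \<otimes> a \<in> I"

locale right_ideal = additive_subgroup I A + ring A for I and A (structure) +
  assumes I_r_closed: "\<lbrakk>a \<in> I; x \<in> carrier A\<rbrakk> \<Longrightarrow> a \<otimes> x \<in> I"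

end

theory Submission
  imports Defs
begin

text \<open>A finitely generated semisimple module has finite length, so the images \<open>\<phi>\<^sup>n(M)\<close> stop
  decreasing at some \<open>V = \<phi>\<^sup>n(M)\<close>. On \<open>V\<close> the map \<open>\<phi>\<close> is surjective, hence injective because
  rank and nullity add up to the length. With \<open>W = ker \<phi>\<^sup>n\<^sup>+\<^sup>1\<close> this gives Fitting's decomposition
  \<open>M = V \<oplus> W\<close> (lemma \<open>fitting_decomposition\<close>): \<open>\<phi>\<close> is nilpotent on \<open>W\<close>, and \<open>W\<close> contains
  \<open>ker \<phi>\<close>. Put \<open>W\<^sub>2 = \<phi>(W)\<close> and let \<open>W\<^sub>1\<close> be any complement of \<open>W\<^sub>2\<close> in \<open>W\<close>, which exists by
  semisimplicity. Counting length in \<open>W\<close> in two ways,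
  \<open>len W\<^sub>1 + len \<phi>(W) = len W = len ker \<phi> + len \<phi>(W)\<close>,
  gives \<open>dim W\<^sub>1 = dim ker \<phi>\<close>.

  If \<open>\<psi>\<phi> = \<phi>\<psi> = 0\<close>, then \<open>\<psi>\<close> vanishes on \<open>V = \<phi>(V)\<close> and has its image in \<open>ker \<phi> \<subseteq> W\<close>. So \<open>\<psi>\<close> is
  determined by its restriction to \<open>W\<close>, which again annihilates \<open>\<phi>|W\<close> on both sides; conversely
  such an endomorphism of \<open>W\<close> extends by zero along the projection of \<open>M\<close> onto \<open>W\<close>. Thus restriction
  is the required isomorphism (lemma \<open>Cen0_restrict_isomorphic\<close>). Since \<open>W = W\<^sub>1 \<oplus> \<phi>(W)\<close>,
  annihilating \<open>\<phi>|W\<close> means killing \<open>W\<^sub>2\<close> and mapping \<open>W\<^sub>1\<close> into \<open>ker \<phi>\<close>, and both ideal properties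
  are then immediate: a left factor must preserve \<open>ker \<phi>\<close>, a right factor must preserve \<open>W\<^sub>2\<close>.

  The dimension is defined by counting simple summands, so it has to be compared with the length of
  composition series in the lattice of submodules, where the Jordan--Hoelder theorem and additivity
  follow from the modular law alone (lemmas \<open>composition_length_unique\<close> and
  \<open>semisimple_dim_eq\<close>).\<close>

section \<open>The lattice of submodules\<close>

context left_module
begin

lemma smult_zero_left: "x \<in> carrier M \<Longrightarrow> \<zero> \<odot>\<^bsub>M\<^esub> x = \<zero>\<^bsub>M\<^esub>"
  by (metis M.add.l_cancel_one' R.l_zero R.zero_closed smult_closed smult_l_distr)

lemma smult_minus_one: "x \<in> carrier M \<Longrightarrow> (\<ominus> \<one>) \<odot>\<^bsub>M\<^esub> x = \<ominus>\<^bsub>M\<^esub> x"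
  by (metis M.minus_equality R.add.inv_closed R.l_neg R.one_closed smult_closed smult_l_distr
      smult_one smult_zero_left)

text \<open>Closure under negation follows from closure under multiplication by \<open>-1\<close>. A description without
  inverses makes it easy to compare submodules of \<open>M\<close> with submodules of a submodule, as the inverse
  operation refers to the carrier while the other operations do not.\<close>

lemma submodule_iff:
  "submodule N R M \<longleftrightarrow> N \<subseteq> carrier M \<and> \<zero>\<^bsub>M\<^esub> \<in> N \<and> (\<forall>x\<in>N. \<forall>y\<in>N. x \<oplus>\<^bsub>M\<^esub> y \<in> N) \<and>
     (\<forall>a\<in>carrier R. \<forall>x\<in>N. a \<odot>\<^bsub>M\<^esub> x \<in> N)"
proof
  assume "submodule N R M"
  then interpret N: submodule N R M .
  show "N \<subseteq> carrier M \<and> \<zero>\<^bsub>M\<^esub> \<in> N \<and> (\<forall>x\<in>N. \<forall>y\<in>N. x \<oplus>\<^bsub>M\<^esub> y \<in> N) \<and>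
     (\<forall>a\<in>carrier R. \<forall>x\<in>N. a \<odot>\<^bsub>M\<^esub> x \<in> N)"
    using N.subset N.one_closed N.m_closed by auto
next
  assume *: "N \<subseteq> carrier M \<and> \<zero>\<^bsub>M\<^esub> \<in> N \<and> (\<forall>x\<in>N. \<forall>y\<in>N. x \<oplus>\<^bsub>M\<^esub> y \<in> N) \<and>
     (\<forall>a\<in>carrier R. \<forall>x\<in>N. a \<odot>\<^bsub>M\<^esub> x \<in> N)"
  have "\<ominus>\<^bsub>M\<^esub> x \<in> N" if "x \<in> N" for x
  proof -
    have "(\<ominus> \<one>) \<odot>\<^bsub>M\<^esub> x \<in> N" using * that by blast
    then show ?thesis using * that smult_minus_one[of x] by force
  qed
  with * show "submodule N R M"
    by (intro submodule.intro subgroup.intro submodule_axioms.intro) (auto simp: a_inv_def)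
qed

lemma submoduleD:
  assumes "submodule N R M"
  shows "N \<subseteq> carrier M" "\<zero>\<^bsub>M\<^esub> \<in> N" "\<And>x y. \<lbrakk>x \<in> N; y \<in> N\<rbrakk> \<Longrightarrow> x \<oplus>\<^bsub>M\<^esub> y \<in> N"
    "\<And>a x. \<lbrakk>a \<in> carrier R; x \<in> N\<rbrakk> \<Longrightarrow> a \<odot>\<^bsub>M\<^esub> x \<in> N" "\<And>x. x \<in> N \<Longrightarrow> x \<in> carrier M"
  using assms unfolding submodule_iff by blast+

lemma submodule_minus: "submodule N R M \<Longrightarrow> x \<in> N \<Longrightarrow> \<ominus>\<^bsub>M\<^esub> x \<in> N"
  by (metis R.add.inv_closed R.one_closed smult_minus_one submoduleD(4,5))

lemma submodule_diff: "submodule N R M \<Longrightarrow> x \<in> N \<Longrightarrow> y \<in> N \<Longrightarrow> x \<ominus>\<^bsub>M\<^esub> y \<in> N"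
  by (simp add: M.minus_eq submodule_minus submoduleD(3))

lemma submodule_carrier: "submodule (carrier M) R M"
  by (auto simp: submodule_iff)

lemma smult_zero_right: "a \<in> carrier R \<Longrightarrow> a \<odot>\<^bsub>M\<^esub> \<zero>\<^bsub>M\<^esub> = \<zero>\<^bsub>M\<^esub>"
  by (metis M.add.l_cancel_one' M.l_zero M.zero_closed smult_closed smult_r_distr)

lemma smult_minus_right:
  assumes "a \<in> carrier R" "x \<in> carrier M"
  shows "a \<odot>\<^bsub>M\<^esub> (\<ominus>\<^bsub>M\<^esub> x) = \<ominus>\<^bsub>M\<^esub> (a \<odot>\<^bsub>M\<^esub> x)"
proof -
  have "a \<odot>\<^bsub>M\<^esub> (\<ominus>\<^bsub>M\<^esub> x) \<oplus>\<^bsub>M\<^esub> a \<odot>\<^bsub>M\<^esub> x = \<zero>\<^bsub>M\<^esub>"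
    using assms smult_r_distr[of a "\<ominus>\<^bsub>M\<^esub> x" x] by (simp add: M.l_neg smult_zero_right)
  then show ?thesis using assms by (intro M.minus_equality [symmetric]) auto
qed

lemma submodule_zero: "submodule {\<zero>\<^bsub>M\<^esub>} R M"
  by (auto simp: submodule_iff smult_zero_right)

lemma submodule_Int: "submodule A R M \<Longrightarrow> submodule B R M \<Longrightarrow> submodule (A \<inter> B) R M"
  by (auto simp: submodule_iff)

lemma left_module_submodule:
  assumes "submodule N R M"
  shows "left_module R (M\<lparr>carrier := N\<rparr>)"
proof (intro left_module.intro left_module_axioms.intro)
  note N = submoduleD[OF assms]
  show "ring R" by unfold_locales
  show "abelian_group (M\<lparr>carrier := N\<rparr>)"
  proof (rule abelian_groupI)
    fix x assume "x \<in> carrier (M\<lparr>carrier := N\<rparr>)"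
    then show "\<exists>y\<in>carrier (M\<lparr>carrier := N\<rparr>).
        y \<oplus>\<^bsub>M\<lparr>carrier := N\<rparr>\<^esub> x = \<zero>\<^bsub>M\<lparr>carrier := N\<rparr>\<^esub>"
      by (auto intro!: bexI[of _ "\<ominus>\<^bsub>M\<^esub> x"] simp: submodule_minus[OF assms] N(5) M.l_neg)
  qed (use N in \<open>auto intro: M.a_assoc M.a_comm\<close>)
qed (use submoduleD[OF assms] smult_l_distr smult_r_distr smult_assoc1 in auto)

lemma submodule_of_submodule_iff:
  assumes "submodule N R M"
  shows "submodule S R (M\<lparr>carrier := N\<rparr>) \<longleftrightarrow> submodule S R M \<and> S \<subseteq> N"
  using left_module.submodule_iff[OF left_module_submodule[OF assms], of S] submodule_iff[of S]
    submoduleD(1)[OF assms] by auto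

lemma set_add_iff: "z \<in> A <+>\<^bsub>M\<^esub> B \<longleftrightarrow> (\<exists>x\<in>A. \<exists>y\<in>B. z = x \<oplus>\<^bsub>M\<^esub> y)"
  by (auto simp: set_add_def')

lemma submodule_sum:
  assumes "submodule A R M" "submodule B R M"
  shows "submodule (A <+>\<^bsub>M\<^esub> B) R M"
proof -
  note A = submoduleD[OF assms(1)] and B = submoduleD[OF assms(2)]
  have "\<exists>x\<in>A. \<exists>y\<in>B. a \<oplus>\<^bsub>M\<^esub> b \<oplus>\<^bsub>M\<^esub> (c \<oplus>\<^bsub>M\<^esub> d) = x \<oplus>\<^bsub>M\<^esub> y"
    if "a \<in> A" "b \<in> B" "c \<in> A" "d \<in> B" for a b c d
    using that A B
    by (intro bexI[of _ "a \<oplus>\<^bsub>M\<^esub> c"] bexI[of _ "b \<oplus>\<^bsub>M\<^esub> d"]) (auto simp: M.a_ac)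
  moreover have "\<exists>x\<in>A. \<exists>y\<in>B. r \<odot>\<^bsub>M\<^esub> (a \<oplus>\<^bsub>M\<^esub> b) = x \<oplus>\<^bsub>M\<^esub> y"
    if "a \<in> A" "b \<in> B" "r \<in> carrier R" for a b r
    using that A B by (metis smult_r_distr)
  moreover have "\<exists>x\<in>A. \<exists>y\<in>B. \<zero>\<^bsub>M\<^esub> = x \<oplus>\<^bsub>M\<^esub> y"
    using A(2) B(2) by (metis M.l_zero M.zero_closed)
  ultimately show ?thesis
    using A(5) B(5) unfolding submodule_iff set_add_iff Ball_def subset_iff
    by (auto simp: set_add_iff) 
qed

lemma sum_upper1: "submodule A R M \<Longrightarrow> submodule B R M \<Longrightarrow> A \<subseteq> A <+>\<^bsub>M\<^esub> B"
  by (metis M.r_zero set_add_iff submoduleD(2,5) subsetI)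

lemma sum_upper2: "submodule A R M \<Longrightarrow> submodule B R M \<Longrightarrow> B \<subseteq> A <+>\<^bsub>M\<^esub> B"
  by (metis M.l_zero set_add_iff submoduleD(2,5) subsetI)

lemma sum_least: "submodule C R M \<Longrightarrow> A \<subseteq> C \<Longrightarrow> B \<subseteq> C \<Longrightarrow> A <+>\<^bsub>M\<^esub> B \<subseteq> C"
  by (auto simp: set_add_iff intro!: submoduleD(3)[of C])

lemma sum_zero_right: "submodule A R M \<Longrightarrow> A <+>\<^bsub>M\<^esub> {\<zero>\<^bsub>M\<^esub>} = A"
  by (auto simp: set_add_iff submoduleD(5))

lemma modular_law:
  assumes "submodule A R M" "submodule B R M" "submodule C R M" "A \<subseteq> C"
  shows "(A <+>\<^bsub>M\<^esub> B) \<inter> C = A <+>\<^bsub>M\<^esub> (B \<inter> C)"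
proof (intro equalityI subsetI)
  fix z assume z: "z \<in> (A <+>\<^bsub>M\<^esub> B) \<inter> C"
  then obtain a b where ab: "a \<in> A" "b \<in> B" "z = a \<oplus>\<^bsub>M\<^esub> b"
    by (auto simp: set_add_iff)
  have "b = (\<ominus>\<^bsub>M\<^esub> a) \<oplus>\<^bsub>M\<^esub> z"
    using ab submoduleD(5)[OF assms(1)] submoduleD(5)[OF assms(2)] by (simp add: M.r_neg1)
  then have "b \<in> C"
    using z ab assms by (metis IntD2 subsetD submoduleD(3) submodule_minus)
  with ab show "z \<in> A <+>\<^bsub>M\<^esub> (B \<inter> C)" by (auto simp: set_add_iff)
next
  fix z assume "z \<in> A <+>\<^bsub>M\<^esub> (B \<inter> C)"
  then show "z \<in> (A <+>\<^bsub>M\<^esub> B) \<inter> C"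
    using assms by (auto simp: set_add_iff intro!: submoduleD(3)[of C])
qed

lemma sum_commute: "submodule A R M \<Longrightarrow> submodule B R M \<Longrightarrow> A <+>\<^bsub>M\<^esub> B = B <+>\<^bsub>M\<^esub> A"
  by (auto simp: set_add_iff) (metis M.a_comm submoduleD(5))+

section \<open>Composition length\<close>

text \<open>That is, \<open>Q / P\<close> is simple.\<close>

definition covers where
  "covers P Q \<longleftrightarrow> submodule P R M \<and> submodule Q R M \<and> P \<subset> Q \<and>
     (\<forall>A. submodule A R M \<longrightarrow> P \<subseteq> A \<longrightarrow> A \<subseteq> Q \<longrightarrow> A = P \<or> A = Q)"

text \<open>This and the next lemma are the two halves of the second isomorphism theorem for simple quotients,
  \<open>(A + B) / A \<cong> B / (A \<inter> B)\<close>, stated in the submodule lattice. By the modular law, \<open>C \<mapsto> B \<inter> C\<close>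
  and \<open>C \<mapsto> A + C\<close> are inverse bijections between the intervals from \<open>A\<close> to \<open>A + B\<close> and from
  \<open>A \<inter> B\<close> to \<open>B\<close>.\<close>

lemma covers_sum_if_covers_Int:
  assumes "submodule A R M" "submodule B R M" "covers (A \<inter> B) B"
  shows "covers A (A <+>\<^bsub>M\<^esub> B)"
  unfolding covers_def
proof (intro conjI allI impI)
  show "submodule (A <+>\<^bsub>M\<^esub> B) R M" using assms submodule_sum by blast
  show "A \<subset> A <+>\<^bsub>M\<^esub> B"
    using assms sum_upper1[of A B] sum_upper2[of A B] unfolding covers_def by blast
  fix C assume C: "submodule C R M" "A \<subseteq> C" "C \<subseteq> A <+>\<^bsub>M\<^esub> B"
  have eq: "C = A <+>\<^bsub>M\<^esub> (B \<inter> C)" using modular_law[OF assms(1,2) C(1,2)] C(3) by blast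
  have "B \<inter> C = A \<inter> B \<or> B \<inter> C = B"
    using assms C submodule_Int unfolding covers_def by (metis Int_lower1 Int_mono inf_commute subset_refl)
  then show "C = A \<or> C = A <+>\<^bsub>M\<^esub> B"
  proof
    assume "B \<inter> C = A \<inter> B"
    then have "C \<subseteq> A"
      using eq sum_least[OF assms(1), of A "B \<inter> C"] by blast
    with C show ?thesis by blast
  qed (use eq in auto)
qed (fact assms(1))

lemma covers_Int_if_covers_sum:
  assumes "submodule A R M" "submodule B R M" "covers A (A <+>\<^bsub>M\<^esub> B)"
  shows "covers (A \<inter> B) B"
  unfolding covers_def
proof (intro conjI allI impI)
  show "submodule (A \<inter> B) R M" using assms submodule_Int by blast
  have "\<not> B \<subseteq> A"
    using assms sum_least[of A A B] unfolding covers_def by blast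
  then show "A \<inter> B \<subset> B" by blast
  fix C assume C: "submodule C R M" "A \<inter> B \<subseteq> C" "C \<subseteq> B"
  have "(C <+>\<^bsub>M\<^esub> A) \<inter> B = C <+>\<^bsub>M\<^esub> (A \<inter> B)"
    using modular_law[of C A B] assms C by blast
  then have eq: "(C <+>\<^bsub>M\<^esub> A) \<inter> B = C"
    using sum_least[of C C "A \<inter> B"] sum_upper1[of C "A \<inter> B"] C assms submodule_Int by blast
  have up: "A \<subseteq> C <+>\<^bsub>M\<^esub> A" "A \<subseteq> A <+>\<^bsub>M\<^esub> B" "B \<subseteq> A <+>\<^bsub>M\<^esub> B"
    using C(1) assms(1,2) sum_upper1 sum_upper2 by simp_all
  have "submodule (C <+>\<^bsub>M\<^esub> A) R M" using C(1) assms(1) submodule_sum by simp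
  moreover have "C <+>\<^bsub>M\<^esub> A \<subseteq> A <+>\<^bsub>M\<^esub> B"
    using C(3) up submodule_sum[OF assms(1,2)] by (intro sum_least) auto
  ultimately have "C <+>\<^bsub>M\<^esub> A = A \<or> C <+>\<^bsub>M\<^esub> A = A <+>\<^bsub>M\<^esub> B"
    using assms(3) up(1) unfolding covers_def by simp
  then show "C = A \<inter> B \<or> C = B"
    using eq sum_upper2[of A B] assms by blast
qed (fact assms(2))

text \<open>Composition series of a submodule; the length is unique by \<open>composition_length_unique\<close> below.\<close>

inductive composition_length where
  zero: "composition_length {\<zero>\<^bsub>M\<^esub>} 0"
| step: "composition_length P n \<Longrightarrow> covers P Q \<Longrightarrow> composition_length Q (Suc n)"

lemma composition_length_submodule: "composition_length N n \<Longrightarrow> submodule N R M"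
  by (induction rule: composition_length.induct) (auto simp: submodule_zero covers_def)

lemma not_covers_zero: "\<not> covers P {\<zero>\<^bsub>M\<^esub>}"
  using submoduleD(2) unfolding covers_def by blast

text \<open>This is the induction that carries the Jordan--Hoelder theorem: if \<open>P\<close> is the last term of the given
  series and \<open>Q \<noteq> P\<close> is another maximal submodule of \<open>N\<close>, then \<open>P + Q = N\<close>, so \<open>P \<inter> Q\<close> is maximal
  in both \<open>P\<close> and \<open>Q\<close>. The shorter series of \<open>P\<close> can therefore be rerouted through \<open>P \<inter> Q\<close> and
  continued to \<open>Q\<close>.\<close>

lemma composition_length_covered:
  assumes "composition_length N n" "covers Q N"
  shows "\<exists>k. n = Suc k \<and> composition_length Q k"
  using assms
proof (induction arbitrary: Q rule: composition_length.induct)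
  case zero
  then show ?case using not_covers_zero by blast
next
  case (step P n N)
  show ?case
  proof (cases "P = Q")
    case True
    with step show ?thesis by blast
  next
    case False
    have sub: "submodule P R M" "submodule Q R M" "P \<subset> N" "Q \<subset> N" "submodule N R M"
      using step unfolding covers_def by blast+
    have "P \<subseteq> P <+>\<^bsub>M\<^esub> Q" "Q \<subseteq> P <+>\<^bsub>M\<^esub> Q" "P <+>\<^bsub>M\<^esub> Q \<subseteq> N" "submodule (P <+>\<^bsub>M\<^esub> Q) R M"
      using sub sum_upper1[of P Q] sum_upper2[of P Q] submodule_sum[of P Q] sum_least[of N P Q] by auto
    then have N: "P <+>\<^bsub>M\<^esub> Q = N"
      using step(2,4) False unfolding covers_def by (metis subset_antisym)
    have "covers (P \<inter> Q) Q" "covers (Q \<inter> P) P"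
      using covers_Int_if_covers_sum[of P Q] covers_Int_if_covers_sum[of Q P] sub N step
        sum_commute[of P Q] by auto
    then show ?thesis
      using step(3)[of "Q \<inter> P"] composition_length.step[of "Q \<inter> P" _ Q]
      by (auto simp: Int_commute)
  qed
qed

lemma composition_length_unique:
  "composition_length N n \<Longrightarrow> composition_length N m \<Longrightarrow> n = m"
proof (induction arbitrary: m rule: composition_length.induct)
  case zero
  then show ?case
    by (cases rule: composition_length.cases) (auto simp: not_covers_zero)
next
  case (step P n Q)
  then show ?case using composition_length_covered by blast
qed

text \<open>Intersecting a composition series of \<open>P\<close> with \<open>N\<close> yields steps that are either equalities or
  covers; if no step collapses, then \<open>N = P\<close>. The strictness clause makes chains of submodules
  terminate.\<close>

lemma composition_length_subset:
  assumes "composition_length P n" "submodule N R M" "N \<subseteq> P"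
  shows "\<exists>m\<le>n. composition_length N m \<and> (m = n \<longrightarrow> N = P)"
  using assms
proof (induction arbitrary: N rule: composition_length.induct)
  case zero
  then have "N = {\<zero>\<^bsub>M\<^esub>}" using submoduleD(2)[of N] by blast
  then show ?case using composition_length.zero by blast
next
  case (step P n Q)
  show ?case
  proof (cases "N \<subseteq> P")
    case True
    then show ?thesis using step(3)[OF step(4)] le_SucI by fastforce
  next
    case False
    have sub: "submodule P R M" "submodule Q R M" "P \<subset> Q" using step unfolding covers_def by blast+
    have "P \<subseteq> P <+>\<^bsub>M\<^esub> N" "N \<subseteq> P <+>\<^bsub>M\<^esub> N" "P <+>\<^bsub>M\<^esub> N \<subseteq> Q" "submodule (P <+>\<^bsub>M\<^esub> N) R M"
      using step sub sum_upper1[of P N] sum_upper2[of P N] submodule_sum[of P N] sum_least[of Q P N] by auto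
    then have Q: "P <+>\<^bsub>M\<^esub> N = Q"
      using step(2) False unfolding covers_def by (metis (no_types))
    have cov: "covers (P \<inter> N) N"
      using covers_Int_if_covers_sum[of P N] Q step(2,4) sub(1) by simp
    obtain m where m: "m \<le> n" "composition_length (P \<inter> N) m" "m = n \<longrightarrow> P \<inter> N = P"
      using step(3)[of "P \<inter> N"] submodule_Int[of P N] sub(1) step(4) by auto
    have "m = n \<longrightarrow> N = Q"
    proof
      assume "m = n"
      then have "P \<subseteq> N" using m(3) by blast
      then have "N = P \<or> N = Q" using step(2,4,5) unfolding covers_def by simp
      then show "N = Q" using False by blast
    qed
    with m cov show ?thesis
      by (intro exI[of _ "Suc m"]) (auto intro: composition_length.step)
  qed
qed

lemma composition_length_0: "composition_length N 0 \<Longrightarrow> N = {\<zero>\<^bsub>M\<^esub>}"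
  by (cases rule: composition_length.cases) auto

text \<open>A series of \<open>B\<close>, shifted by \<open>A\<close>, continues a series of \<open>A\<close>.\<close>

lemma composition_length_direct_sum:
  assumes "composition_length B b" "composition_length A a" "A \<inter> B = {\<zero>\<^bsub>M\<^esub>}"
  shows "composition_length (A <+>\<^bsub>M\<^esub> B) (a + b)"
  using assms
proof (induction rule: composition_length.induct)
  case zero
  then show ?case by (simp add: sum_zero_right composition_length_submodule)
next
  case (step P n Q)
  have sub: "submodule P R M" "submodule Q R M" "P \<subseteq> Q" "submodule A R M"
    using step composition_length_submodule unfolding covers_def by blast+
  have 0: "\<zero>\<^bsub>M\<^esub> \<in> P" "\<zero>\<^bsub>M\<^esub> \<in> A" using sub submoduleD(2) by blast+
  have "(P <+>\<^bsub>M\<^esub> A) \<inter> Q = P"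
    using modular_law[of P A Q] sub step.prems sum_zero_right by simp
  then have *: "(A <+>\<^bsub>M\<^esub> P) \<inter> Q = P" using sum_commute sub by simp
  have "covers (A <+>\<^bsub>M\<^esub> P) ((A <+>\<^bsub>M\<^esub> P) <+>\<^bsub>M\<^esub> Q)"
    by (rule covers_sum_if_covers_Int) (use sub submodule_sum * step in auto)
  moreover have "(A <+>\<^bsub>M\<^esub> P) <+>\<^bsub>M\<^esub> Q = A <+>\<^bsub>M\<^esub> Q"
    using sub sum_upper1[of A Q] sum_upper2[of A Q] sum_upper1[of A P]
      sum_upper1[of "A <+>\<^bsub>M\<^esub> P" Q] sum_upper2[of "A <+>\<^bsub>M\<^esub> P" Q] submodule_sum[of A P]
      submodule_sum[of A Q] submodule_sum[of "A <+>\<^bsub>M\<^esub> P" Q]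
    by (intro equalityI sum_least) auto
  moreover have "A \<inter> P = {\<zero>\<^bsub>M\<^esub>}" using step.prems sub 0 by blast
  ultimately show ?case
    using step composition_length.step by (metis add_Suc_right)
qed

section \<open>Simple decompositions\<close>

lemma module_span_submodule: "A \<subseteq> carrier M \<Longrightarrow> submodule (module_span R M A) R M"
proof -
  assume "A \<subseteq> carrier M"
  then have "module_span R M A \<subseteq> carrier M"
    using submodule_carrier unfolding module_span_def by blast
  then show ?thesis
    unfolding submodule_iff by (auto simp: module_span_def intro: submoduleD(2,3,4))
qed

lemma module_span_superset: "A \<subseteq> module_span R M A"
  unfolding module_span_def by blast

lemma module_span_least: "submodule N R M \<Longrightarrow> A \<subseteq> N \<Longrightarrow> module_span R M A \<subseteq> N"
  unfolding module_span_def by blast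

lemma module_span_mono: "A \<subseteq> B \<Longrightarrow> module_span R M A \<subseteq> module_span R M B"
  unfolding module_span_def by blast

lemma module_span_of_submodule:
  assumes "submodule N R M" "A \<subseteq> N"
  shows "module_span R (M\<lparr>carrier := N\<rparr>) A = module_span R M A"
proof
  show "module_span R M A \<subseteq> module_span R (M\<lparr>carrier := N\<rparr>) A"
    unfolding module_span_def submodule_of_submodule_iff[OF assms(1)] by blast
  have "submodule (module_span R M A) R M" "module_span R M A \<subseteq> N"
    using assms module_span_submodule[of A] module_span_least submoduleD(1)[OF assms(1)] by auto
  then show "module_span R (M\<lparr>carrier := N\<rparr>) A \<subseteq> module_span R M A"
    using module_span_superset[of A]
    unfolding module_span_def[of R "M\<lparr>carrier := N\<rparr>"] submodule_of_submodule_iff[OF assms(1)]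
    by (intro Inter_lower) simp
qed

lemma module_span_Union_insert:
  assumes "submodule S R M" "\<Union>F \<subseteq> carrier M"
  shows "module_span R M (\<Union>(insert S F)) = module_span R M (\<Union>F) <+>\<^bsub>M\<^esub> S"
proof
  have sub: "submodule (module_span R M (\<Union>F)) R M" using assms module_span_submodule by simp
  show "module_span R M (\<Union>(insert S F)) \<subseteq> module_span R M (\<Union>F) <+>\<^bsub>M\<^esub> S"
    using submodule_sum[OF sub assms(1)] sum_upper1[OF sub assms(1)] sum_upper2[OF sub assms(1)]
      module_span_superset[of "\<Union>F"]
    by (intro module_span_least) auto
  show "module_span R M (\<Union>F) <+>\<^bsub>M\<^esub> S \<subseteq> module_span R M (\<Union>(insert S F))"
    using module_span_submodule[of "\<Union>(insert S F)"] assms submoduleD(1)[OF assms(1)]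
      module_span_superset[of "\<Union>(insert S F)"] module_span_mono[of "\<Union>F" "\<Union>(insert S F)"]
    by (intro sum_least) auto
qed

lemma module_span_empty: "module_span R M {} = {\<zero>\<^bsub>M\<^esub>}"
  using module_span_least[OF submodule_zero, of "{}"] submoduleD(2)[OF module_span_submodule[of "{}"]]
  by auto

lemma simple_module_iff_covers_zero:
  assumes "submodule S R M"
  shows "simple_module R (M\<lparr>carrier := S\<rparr>) \<longleftrightarrow> covers {\<zero>\<^bsub>M\<^esub>} S"
  using assms submodule_zero submoduleD(2)
  unfolding simple_module_def covers_def submodule_of_submodule_iff[OF assms] by auto

text \<open>The part of \<^const>\<open>simple_decomposition\<close> that does not mention the module being decomposed; it is the
  same for all submodules of \<open>M\<close> that contain the family.\<close>

definition independent where
  "independent F \<longleftrightarrow> (\<forall>S\<in>F. covers {\<zero>\<^bsub>M\<^esub>} S) \<and>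
     (\<forall>S\<in>F. S \<inter> module_span R M (\<Union>(F - {S})) = {\<zero>\<^bsub>M\<^esub>})"

lemma independent_subset_carrier: "independent F \<Longrightarrow> \<Union>F \<subseteq> carrier M"
  using submoduleD(1) unfolding independent_def covers_def by blast

lemma simple_decomposition_iff_independent:
  assumes "submodule N R M"
  shows "simple_decomposition R (M\<lparr>carrier := N\<rparr>) F \<longleftrightarrow>
    independent F \<and> module_span R M (\<Union>F) = N"
proof
  assume *: "simple_decomposition R (M\<lparr>carrier := N\<rparr>) F"
  then have sub: "submodule S R M" "S \<subseteq> N" if "S \<in> F" for S
    using that unfolding simple_decomposition_def submodule_of_submodule_iff[OF assms] by auto
  have span: "module_span R (M\<lparr>carrier := N\<rparr>) (\<Union>G) = module_span R M (\<Union>G)" if "G \<subseteq> F" for G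
    using that sub by (intro module_span_of_submodule[OF assms]) auto
  show "independent F \<and> module_span R M (\<Union>F) = N"
    using * sub span[of F] span[of "F - {_}"]
    unfolding simple_decomposition_def independent_def
    by (auto simp: simple_module_iff_covers_zero)
next
  assume *: "independent F \<and> module_span R M (\<Union>F) = N"
  then have sub: "submodule S R M" "S \<subseteq> N" if "S \<in> F" for S
    using that module_span_superset[of "\<Union>F"] unfolding independent_def covers_def by auto
  have span: "module_span R (M\<lparr>carrier := N\<rparr>) (\<Union>G) = module_span R M (\<Union>G)" if "G \<subseteq> F" for G
    using that sub by (intro module_span_of_submodule[OF assms]) auto
  show "simple_decomposition R (M\<lparr>carrier := N\<rparr>) F"
    using * sub span[of F] span[of "F - {_}"]
    unfolding simple_decomposition_def independent_def submodule_of_submodule_iff[OF assms]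
    by (auto simp: simple_module_iff_covers_zero)
qed

lemma independent_mono:
  assumes "independent F" "G \<subseteq> F"
  shows "independent G"
  unfolding independent_def
proof (intro conjI ballI)
  fix S assume S: "S \<in> G"
  show "covers {\<zero>\<^bsub>M\<^esub>} S" using S assms unfolding independent_def by blast
  have "module_span R M (\<Union>(G - {S})) \<subseteq> module_span R M (\<Union>(F - {S}))"
    using assms(2) by (intro module_span_mono) blast
  moreover have "S \<inter> module_span R M (\<Union>(F - {S})) = {\<zero>\<^bsub>M\<^esub>}"
    using S assms unfolding independent_def by blast
  moreover have "\<zero>\<^bsub>M\<^esub> \<in> S" "\<zero>\<^bsub>M\<^esub> \<in> module_span R M (\<Union>(G - {S}))"
    using S independent_subset_carrier[OF assms(1)] assms(2) \<open>covers {\<zero>\<^bsub>M\<^esub>} S\<close>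
    by (auto simp: covers_def intro!: submoduleD(2) module_span_submodule)
  ultimately show "S \<inter> module_span R M (\<Union>(G - {S})) = {\<zero>\<^bsub>M\<^esub>}" by blast
qed

text \<open>For \<open>T \<in> F\<close> let \<open>P\<close> be the span of the other members of \<open>F\<close> and \<open>Q\<close> the span of \<open>F\<close>. By the modular
  law \<open>(P + S) \<inter> Q = P\<close>, so adding \<open>S\<close> to \<open>P\<close> creates no new intersection with \<open>T \<subseteq> Q\<close>.\<close>

lemma independent_insert:
  assumes "independent F" "covers {\<zero>\<^bsub>M\<^esub>} S" "S \<inter> module_span R M (\<Union>F) = {\<zero>\<^bsub>M\<^esub>}"
  shows "independent (insert S F)"
proof -
  have S: "submodule S R M" "S \<noteq> {\<zero>\<^bsub>M\<^esub>}" "S \<notin> F"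
    using assms(2,3) module_span_superset[of "\<Union>F"] unfolding covers_def by auto
  have "T \<inter> module_span R M (\<Union>(insert S F - {T})) = {\<zero>\<^bsub>M\<^esub>}" if T: "T \<in> F" for T
  proof -
    let ?P = "module_span R M (\<Union>(F - {T}))" and ?Q = "module_span R M (\<Union>F)"
    have carr: "\<Union>F \<subseteq> carrier M" "\<Union>(F - {T}) \<subseteq> carrier M"
      using independent_subset_carrier[OF assms(1)] by auto
    have sub: "submodule ?P R M" "submodule ?Q R M" "?P \<subseteq> ?Q" "T \<subseteq> ?Q" "T \<inter> ?P = {\<zero>\<^bsub>M\<^esub>}"
      using carr module_span_submodule module_span_mono[of "\<Union>(F - {T})" "\<Union>F"] T
        module_span_superset[of "\<Union>F"] assms(1) unfolding independent_def by auto
    have "insert S F - {T} = insert S (F - {T})" using S T by blast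
    then have eq: "module_span R M (\<Union>(insert S F - {T})) = ?P <+>\<^bsub>M\<^esub> S"
      using module_span_Union_insert[OF S(1) carr(2)] by simp
    have "(?P <+>\<^bsub>M\<^esub> S) \<inter> ?Q = ?P"
      using modular_law[OF sub(1) S(1) sub(2,3)] assms(3) sum_zero_right[OF sub(1)] by simp
    with sub eq show ?thesis by blast
  qed
  moreover have "insert S F - {S} = F" using S by blast
  ultimately show ?thesis
    using assms unfolding independent_def by auto
qed

text \<open>Adding the simple summands one at a time produces a composition series.\<close>

lemma composition_length_independent:
  assumes "finite F" "independent F"
  shows "composition_length (module_span R M (\<Union>F)) (card F)"
  using assms
proof (induction rule: finite_induct)
  case empty
  then show ?case using composition_length.zero by (simp add: module_span_empty)
next
  case (insert S F)
  have F: "independent F" using insert.prems by (rule independent_mono) blast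
  have S: "submodule S R M" "covers {\<zero>\<^bsub>M\<^esub>} S" "insert S F - {S} = F"
    using insert unfolding independent_def covers_def by auto
  have carr: "\<Union>F \<subseteq> carrier M" using F independent_subset_carrier by simp
  have "module_span R M (\<Union>F) \<inter> S = {\<zero>\<^bsub>M\<^esub>}"
    using insert.prems S(3) unfolding independent_def by auto
  then have "covers (module_span R M (\<Union>F)) (module_span R M (\<Union>F) <+>\<^bsub>M\<^esub> S)"
    using S carr module_span_submodule by (intro covers_sum_if_covers_Int) auto
  then show ?case
    using insert.IH[OF F] insert.hyps module_span_Union_insert[OF S(1) carr]
    by (auto intro: composition_length.step)
qed

text \<open>The elements that lie in the span of finitely many members of \<open>D\<close> already form a submodule.\<close>

lemma module_span_finite_subset:
  assumes "\<Union>D \<subseteq> carrier M" "x \<in> module_span R M (\<Union>D)"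
  shows "\<exists>F. finite F \<and> F \<subseteq> D \<and> x \<in> module_span R M (\<Union>F)"
proof -
  define N where "N = {x. \<exists>F. finite F \<and> F \<subseteq> D \<and> x \<in> module_span R M (\<Union>F)}"
  have sub: "submodule (module_span R M (\<Union>F)) R M" if "F \<subseteq> D" for F
    using that assms(1) by (intro module_span_submodule) blast
  have "x \<oplus>\<^bsub>M\<^esub> y \<in> N" if "x \<in> N" "y \<in> N" for x y
  proof -
    from that[unfolded N_def] obtain F G where FG: "finite F" "F \<subseteq> D" "x \<in> module_span R M (\<Union>F)"
      "finite G" "G \<subseteq> D" "y \<in> module_span R M (\<Union>G)" by auto
    have "x \<in> module_span R M (\<Union>(F \<union> G))" "y \<in> module_span R M (\<Union>(F \<union> G))"
      using FG module_span_mono[of "\<Union>F" "\<Union>(F \<union> G)"] module_span_mono[of "\<Union>G" "\<Union>(F \<union> G)"] by auto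
    then have "x \<oplus>\<^bsub>M\<^esub> y \<in> module_span R M (\<Union>(F \<union> G))"
      using submoduleD(3)[OF sub[of "F \<union> G"]] FG by simp
    with FG show ?thesis by (auto simp: N_def intro!: exI[of _ "F \<union> G"])
  qed
  moreover have "a \<odot>\<^bsub>M\<^esub> x \<in> N" if "x \<in> N" "a \<in> carrier R" for x a
    using that submoduleD(4)[OF sub] unfolding N_def by blast
  moreover have "\<zero>\<^bsub>M\<^esub> \<in> N"
    using submoduleD(2)[OF sub[of "{}"]] unfolding N_def by blast
  moreover have "N \<subseteq> carrier M"
    using submoduleD(1)[OF sub] unfolding N_def by blast
  ultimately have "submodule N R M"
    unfolding submodule_iff by blast
  moreover have "\<Union>D \<subseteq> N"
  proof
    fix x assume "x \<in> \<Union>D"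
    then obtain S where "S \<in> D" "x \<in> S" by blast
    then show "x \<in> N"
      using module_span_superset[of "\<Union>{S}"] unfolding N_def by (intro CollectI exI[of _ "{S}"]) auto
  qed
  ultimately show ?thesis
    using module_span_least[of N "\<Union>D"] assms(2) unfolding N_def by blast
qed

end

locale fg_semisimple_module = left_module +
  assumes finitely_generated: "finitely_generated_module R M"
    and semisimple: "semisimple_module R M"
begin

text \<open>Finitely many generators lie in the span of finitely many simple summands, and those form a
  decomposition by themselves.\<close>

lemma finite_simple_decomposition:
  "\<exists>F. finite F \<and> independent F \<and> module_span R M (\<Union>F) = carrier M"
proof -
  obtain A where A: "finite A" "A \<subseteq> carrier M" "module_span R M A = carrier M"
    using finitely_generated unfolding finitely_generated_module_def by blast
  obtain D where "simple_decomposition R M D"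
    using semisimple unfolding semisimple_module_def by blast
  then have S: "independent D" "module_span R M (\<Union>D) = carrier M"
    using simple_decomposition_iff_independent[OF submodule_carrier, of D] by simp_all
  have carr: "\<Union>D \<subseteq> carrier M" by (rule independent_subset_carrier[OF S(1)])
  have "\<forall>x\<in>A. \<exists>F. finite F \<and> F \<subseteq> D \<and> x \<in> module_span R M (\<Union>F)"
    using module_span_finite_subset[OF carr] S A by blast
  then obtain F where F: "\<And>x. x \<in> A \<Longrightarrow> finite (F x) \<and> F x \<subseteq> D \<and> x \<in> module_span R M (\<Union>(F x))"
    by metis
  let ?G = "\<Union>x\<in>A. F x"
  have G: "finite ?G" "?G \<subseteq> D" using A F by auto
  have sub: "submodule (module_span R M (\<Union>?G)) R M"
    using G carr by (intro module_span_submodule) blast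
  have "A \<subseteq> module_span R M (\<Union>?G)"
  proof
    fix x assume x: "x \<in> A"
    then have "module_span R M (\<Union>(F x)) \<subseteq> module_span R M (\<Union>?G)"
      by (intro module_span_mono) blast
    with F[OF x] show "x \<in> module_span R M (\<Union>?G)" by blast
  qed
  then have "module_span R M (\<Union>?G) = carrier M"
    using module_span_least[OF sub] A(3) submoduleD(1)[OF sub] by blast
  with G independent_mono[OF S(1) G(2)] show ?thesis by blast
qed

lemma composition_length_exists: "submodule N R M \<Longrightarrow> \<exists>n. composition_length N n"
  using finite_simple_decomposition composition_length_independent composition_length_subset
    submoduleD(1)[of N] by metis

text \<open>Take a maximal subfamily \<open>G\<close> of the simple summands whose span \<open>C\<close> meets \<open>N\<close> trivially. A summand
  \<open>S\<close> outside \<open>N + C\<close> would meet \<open>N + C\<close> trivially, and could then be added to \<open>G\<close>.\<close>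

lemma complement_exists:
  assumes N: "submodule N R M"
  shows "\<exists>C. submodule C R M \<and> N <+>\<^bsub>M\<^esub> C = carrier M \<and> N \<inter> C = {\<zero>\<^bsub>M\<^esub>}"
proof -
  obtain F where F: "finite F" "independent F" "module_span R M (\<Union>F) = carrier M"
    using finite_simple_decomposition by blast
  have carr: "\<Union>G \<subseteq> carrier M" if "G \<subseteq> F" for G
    using that independent_subset_carrier[OF F(2)] by blast
  define P where "P G \<longleftrightarrow> G \<subseteq> F \<and> N \<inter> module_span R M (\<Union>G) = {\<zero>\<^bsub>M\<^esub>}" for G
  have "P {}"
    using submoduleD(2)[OF N] unfolding P_def by (simp add: module_span_empty)
  moreover have "finite {G. P G}"
    using F(1) unfolding P_def by simp
  ultimately obtain G where G: "P G" and max: "\<And>H. P H \<Longrightarrow> G \<subseteq> H \<Longrightarrow> G = H"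
    using finite_has_maximal[of "{G. P G}"] by auto
  let ?C = "module_span R M (\<Union>G)"
  have C: "submodule ?C R M" "N \<inter> ?C = {\<zero>\<^bsub>M\<^esub>}"
    using G carr module_span_submodule unfolding P_def by auto
  have sum: "submodule (N <+>\<^bsub>M\<^esub> ?C) R M" using N C submodule_sum by simp
  have "S \<subseteq> N <+>\<^bsub>M\<^esub> ?C" if S: "S \<in> F" for S
  proof (rule ccontr)
    assume not: "\<not> S \<subseteq> N <+>\<^bsub>M\<^esub> ?C"
    have cov: "submodule S R M" "covers {\<zero>\<^bsub>M\<^esub>} S" using S F(2) unfolding independent_def covers_def by auto
    have "submodule (S \<inter> (N <+>\<^bsub>M\<^esub> ?C)) R M" using cov(1) sum submodule_Int by simp
    then have 0: "S \<inter> (N <+>\<^bsub>M\<^esub> ?C) = {\<zero>\<^bsub>M\<^esub>}"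
      using cov(2) not submoduleD(2) unfolding covers_def by blast
    have S_G: "S \<notin> G"
      using not module_span_superset[of "\<Union>G"] sum_upper2[OF N C(1)] by blast
    have CS: "submodule (?C <+>\<^bsub>M\<^esub> S) R M" using C cov submodule_sum by simp
    have "(?C <+>\<^bsub>M\<^esub> S) \<inter> (N <+>\<^bsub>M\<^esub> ?C) = ?C"
      using modular_law[OF C(1) cov(1) sum] sum_upper2[OF N C(1)] 0 sum_zero_right[OF C(1)] by simp
    then have "N \<inter> (?C <+>\<^bsub>M\<^esub> S) = {\<zero>\<^bsub>M\<^esub>}"
      using C(2) sum_upper1[OF N C(1)] sum_upper1[OF C(1) cov(1)] by blast
    then have "P (insert S G)"
      using module_span_Union_insert[OF cov(1) carr[of G]] G S unfolding P_def by simp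
    with max[of "insert S G"] S_G show False by blast
  qed
  then have "module_span R M (\<Union>F) \<subseteq> N <+>\<^bsub>M\<^esub> ?C"
    by (intro module_span_least[OF sum]) blast
  with F(3) C submoduleD(1)[OF sum] show ?thesis by blast
qed

lemma relative_complement_exists:
  assumes "submodule A R M" "submodule B R M" "A \<subseteq> B"
  shows "\<exists>C. submodule C R M \<and> A <+>\<^bsub>M\<^esub> C = B \<and> A \<inter> C = {\<zero>\<^bsub>M\<^esub>}"
proof -
  obtain C where C: "submodule C R M" "A <+>\<^bsub>M\<^esub> C = carrier M" "A \<inter> C = {\<zero>\<^bsub>M\<^esub>}"
    using complement_exists[OF assms(1)] by blast
  have "A <+>\<^bsub>M\<^esub> (C \<inter> B) = B"
    using modular_law[OF assms(1) C(1) assms(2,3)] C(2) submoduleD(1)[OF assms(2)] by auto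
  moreover have "A \<inter> (C \<inter> B) = {\<zero>\<^bsub>M\<^esub>}"
    using C(3) submoduleD(2)[OF assms(2)] by auto
  ultimately show ?thesis using submodule_Int[OF C(1) assms(2)] by blast
qed

text \<open>By semisimplicity each step \<open>P \<subset> Q\<close> of a composition series splits off a complement of \<open>P\<close> in \<open>Q\<close>,
  which is simple because it is isomorphic to \<open>Q / P\<close>.\<close>

lemma simple_decomposition_of_composition_length:
  assumes "composition_length N n"
  shows "\<exists>F. finite F \<and> independent F \<and> module_span R M (\<Union>F) = N \<and> card F = n"
  using assms
proof (induction rule: composition_length.induct)
  case zero
  show ?case
    by (intro exI[of _ "{}"]) (simp add: module_span_empty independent_def)
next
  case (step P n Q)
  then obtain F where F: "finite F" "independent F" "module_span R M (\<Union>F) = P" "card F = n"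
    by blast
  have sub: "submodule P R M" "submodule Q R M" "P \<subset> Q" using step(2) unfolding covers_def by auto
  then obtain S where S: "submodule S R M" "P <+>\<^bsub>M\<^esub> S = Q" "P \<inter> S = {\<zero>\<^bsub>M\<^esub>}"
    using relative_complement_exists[of P Q] by auto
  have cov: "covers {\<zero>\<^bsub>M\<^esub>} S"
    using covers_Int_if_covers_sum[OF sub(1) S(1)] S step(2) by simp
  have "S \<notin> F"
    using cov S(3) F(3) module_span_superset[of "\<Union>F"] unfolding covers_def by blast
  moreover have "independent (insert S F)"
    using independent_insert[OF F(2) cov] F(3) S(3) by (simp add: Int_commute)
  moreover have "module_span R M (\<Union>(insert S F)) = Q"
    using module_span_Union_insert[OF S(1) independent_subset_carrier[OF F(2)]] F(3) S(2) by simp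
  ultimately show ?case
    using F by (intro exI[of _ "insert S F"]) simp
qed

text \<open>The definite description in \<^const>\<open>semisimple_dim\<close> is justified here: every finite simple
  decomposition yields a composition series with as many steps as it has members, and conversely
  such a decomposition exists.\<close>

lemma semisimple_dim_eq:
  assumes "composition_length N n"
  shows "semisimple_dim R (M\<lparr>carrier := N\<rparr>) = n"
proof -
  have N: "submodule N R M" using assms by (rule composition_length_submodule)
  show ?thesis
    unfolding semisimple_dim_def simple_decomposition_iff_independent[OF N]
  proof (rule the_equality)
    show "\<exists>F. finite F \<and> (independent F \<and> module_span R M (\<Union>F) = N) \<and> card F = n"
      using simple_decomposition_of_composition_length[OF assms] by blast
    fix m assume "\<exists>F. finite F \<and> (independent F \<and> module_span R M (\<Union>F) = N) \<and> card F = m"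
    then show "m = n"
      using composition_length_independent composition_length_unique[OF assms] by blast
  qed
qed

end

section \<open>Fitting decomposition\<close>

context left_module
begin

lemma End_carrier_iff:
  "f \<in> carrier (module_End R M) \<longleftrightarrow> f \<in> extensional (carrier M) \<and> f ` carrier M \<subseteq> carrier M \<and>
     (\<forall>x\<in>carrier M. \<forall>y\<in>carrier M. f (x \<oplus>\<^bsub>M\<^esub> y) = f x \<oplus>\<^bsub>M\<^esub> f y) \<and>
     (\<forall>a\<in>carrier R. \<forall>x\<in>carrier M. f (a \<odot>\<^bsub>M\<^esub> x) = a \<odot>\<^bsub>M\<^esub> f x)"
  by (auto simp: module_End_def PiE_iff)

lemma EndD:
  assumes "f \<in> carrier (module_End R M)"
  shows "\<And>x. x \<in> carrier M \<Longrightarrow> f x \<in> carrier M"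
    "\<And>x y. \<lbrakk>x \<in> carrier M; y \<in> carrier M\<rbrakk> \<Longrightarrow> f (x \<oplus>\<^bsub>M\<^esub> y) = f x \<oplus>\<^bsub>M\<^esub> f y"
    "\<And>a x. \<lbrakk>a \<in> carrier R; x \<in> carrier M\<rbrakk> \<Longrightarrow> f (a \<odot>\<^bsub>M\<^esub> x) = a \<odot>\<^bsub>M\<^esub> f x"
    "f \<in> extensional (carrier M)"
  using assms unfolding End_carrier_iff by blast+

lemma End_apply_zero:
  assumes "f \<in> carrier (module_End R M)"
  shows "f \<zero>\<^bsub>M\<^esub> = \<zero>\<^bsub>M\<^esub>"
  using EndD(1)[OF assms, of "\<zero>\<^bsub>M\<^esub>"] EndD(3)[OF assms, of "\<zero>" "\<zero>\<^bsub>M\<^esub>"]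
  by (simp add: smult_zero_left)

lemma End_apply_diff:
  assumes f: "f \<in> carrier (module_End R M)" and "x \<in> carrier M" "y \<in> carrier M"
  shows "f (x \<ominus>\<^bsub>M\<^esub> y) = f x \<ominus>\<^bsub>M\<^esub> f y"
proof -
  have "f (\<ominus>\<^bsub>M\<^esub> y) = \<ominus>\<^bsub>M\<^esub> f y"
    using EndD(1)[OF f assms(3)] EndD(3)[OF f _ assms(3), of "\<ominus> \<one>"] assms(3)
    by (simp add: smult_minus_one)
  then show ?thesis
    using EndD(2)[OF f assms(2), of "\<ominus>\<^bsub>M\<^esub> y"] assms(3) by (simp add: M.minus_eq)
qed

lemma image_submodule:
  assumes f: "f \<in> carrier (module_End R M)" and N: "submodule N R M"
  shows "submodule (f ` N) R M"
  unfolding submodule_iff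
proof (intro conjI ballI)
  note N = submoduleD[OF N] and z = End_apply_zero[OF f] and f = EndD[OF f]
  show "f ` N \<subseteq> carrier M" using N f by auto
  show "\<zero>\<^bsub>M\<^esub> \<in> f ` N" using N(2) z by (metis imageI)
  show "x \<oplus>\<^bsub>M\<^esub> y \<in> f ` N" if xy: "x \<in> f ` N" "y \<in> f ` N" for x y
  proof -
    from xy obtain a b where "a \<in> N" "b \<in> N" "x = f a" "y = f b" by blast
    then show ?thesis using N f(2)[of a b] by (metis imageI)
  qed
  show "r \<odot>\<^bsub>M\<^esub> x \<in> f ` N" if rx: "r \<in> carrier R" "x \<in> f ` N" for r x
  proof -
    from rx obtain a where "a \<in> N" "x = f a" by blast
    then show ?thesis using N f(3)[of r a] rx(1) by (metis imageI)
  qed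
qed

lemma preimage_submodule:
  assumes f: "f \<in> carrier (module_End R M)" and N: "submodule N R M" and Q: "submodule Q R M"
  shows "submodule {x \<in> N. f x \<in> Q} R M"
  unfolding submodule_iff
  using submoduleD[OF N] submoduleD[OF Q] EndD[OF f] End_apply_zero[OF f] by auto

lemma a_kernel_eq: "a_kernel M M f = {x \<in> carrier M. f x \<in> {\<zero>\<^bsub>M\<^esub>}}"
  by (auto simp: a_kernel_def')

text \<open>Rank and nullity: the preimages of a composition series of \<open>Q \<subseteq> f(N)\<close> form a series that starts
  at the kernel of \<open>f\<close> on \<open>N\<close>. A submodule between two successive preimages contains that kernel, so
  it is the preimage of its image and the step is again a cover. The uses below have \<open>Q = f(N)\<close>; the
  general form is what the induction needs.\<close>

lemma composition_length_preimage:
  assumes f: "f \<in> carrier (module_End R M)" and N: "submodule N R M"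
    and ker: "composition_length {x \<in> N. f x = \<zero>\<^bsub>M\<^esub>} k"
    and "composition_length Q w" and "Q \<subseteq> f ` N"
  shows "composition_length {x \<in> N. f x \<in> Q} (k + w)"
  using assms(4,5)
proof (induction rule: composition_length.induct)
  case zero
  then show ?case using ker by simp
next
  case (step P n Q)
  have sub: "submodule P R M" "submodule Q R M" "P \<subseteq> Q" "P \<noteq> Q"
    using step(2) unfolding covers_def by auto
  have "covers {x \<in> N. f x \<in> P} {x \<in> N. f x \<in> Q}"
    unfolding covers_def
  proof (intro conjI allI impI)
    show "submodule {x \<in> N. f x \<in> P} R M" "submodule {x \<in> N. f x \<in> Q} R M"
      using preimage_submodule[OF f N] sub by auto
    show "{x \<in> N. f x \<in> P} \<subset> {x \<in> N. f x \<in> Q}" using sub step.prems by blast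
    fix A assume A: "submodule A R M" "{x \<in> N. f x \<in> P} \<subseteq> A" "A \<subseteq> {x \<in> N. f x \<in> Q}"
    have "P \<subseteq> f ` A"
    proof
      fix p assume "p \<in> P"
      then obtain x where "x \<in> N" "f x = p" using sub step.prems by blast
      with \<open>p \<in> P\<close> A(2) show "p \<in> f ` A" by blast
    qed
    moreover have "f ` A \<subseteq> Q" using A(3) by blast
    ultimately have "f ` A = P \<or> f ` A = Q"
      using step(2) image_submodule[OF f A(1)] unfolding covers_def by simp
    then show "A = {x \<in> N. f x \<in> P} \<or> A = {x \<in> N. f x \<in> Q}"
    proof
      assume "f ` A = P"
      then show ?thesis using A by blast
    next
      assume img: "f ` A = Q"
      have "x \<in> A" if x: "x \<in> N" "f x \<in> Q" for x
      proof -
        obtain a where a: "a \<in> A" "f x = f a" using img x(2) by blast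
        have carr: "x \<in> carrier M" "a \<in> carrier M"
          using x(1) a(1) submoduleD(5)[OF N] submoduleD(5)[OF A(1)] by auto
        then have "f (x \<ominus>\<^bsub>M\<^esub> a) = \<zero>\<^bsub>M\<^esub>"
          using End_apply_diff[OF f] EndD(1)[OF f] a(2) by (simp add: M.r_neg M.minus_eq)
        moreover have "x \<ominus>\<^bsub>M\<^esub> a \<in> N" using submodule_diff[OF N x(1)] a(1) A(3) by auto
        ultimately have "x \<ominus>\<^bsub>M\<^esub> a \<in> A" using A(2) submoduleD(2)[OF sub(1)] by auto
        then have "(x \<ominus>\<^bsub>M\<^esub> a) \<oplus>\<^bsub>M\<^esub> a \<in> A" using a(1) submoduleD(3)[OF A(1)] by simp
        then show "x \<in> A" using carr by (simp add: M.minus_eq M.a_assoc M.l_neg)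
      qed
      with A(3) show ?thesis by blast
    qed
  qed
  moreover have "composition_length {x \<in> N. f x \<in> P} (k + n)"
    using step.IH step.prems sub by simp
  ultimately show ?case using composition_length.step by simp
qed

lemma funpow_closed:
  "f \<in> carrier (module_End R M) \<Longrightarrow> x \<in> carrier M \<Longrightarrow> (f ^^ i) x \<in> carrier M"
  by (induction i) (auto simp: EndD(1))

lemma funpow_diff:
  "f \<in> carrier (module_End R M) \<Longrightarrow> x \<in> carrier M \<Longrightarrow> y \<in> carrier M \<Longrightarrow>
    (f ^^ i) (x \<ominus>\<^bsub>M\<^esub> y) = (f ^^ i) x \<ominus>\<^bsub>M\<^esub> (f ^^ i) y"
  by (induction i) (auto simp: End_apply_diff funpow_closed)

lemma funpow_image_submodule:
  "f \<in> carrier (module_End R M) \<Longrightarrow> submodule ((f ^^ i) ` carrier M) R M"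
proof (induction i)
  case (Suc i)
  then show ?case using image_submodule[of f "(f ^^ i) ` carrier M"] by (simp add: image_image)
qed (simp add: submodule_carrier)

lemma funpow_kernel_submodule:
  assumes f: "f \<in> carrier (module_End R M)"
  shows "submodule {x \<in> carrier M. (f ^^ i) x = \<zero>\<^bsub>M\<^esub>} R M"
proof (induction i)
  case 0
  have "{x \<in> carrier M. (f ^^ 0) x = \<zero>\<^bsub>M\<^esub>} = {\<zero>\<^bsub>M\<^esub>}" by auto
  then show ?case using submodule_zero by simp
next
  case (Suc i)
  have "{x \<in> carrier M. (f ^^ Suc i) x = \<zero>\<^bsub>M\<^esub>} =
      {x \<in> carrier M. f x \<in> {x \<in> carrier M. (f ^^ i) x = \<zero>\<^bsub>M\<^esub>}}"
    using EndD(1)[OF f] by (auto simp: funpow_swap1)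
  then show ?case using preimage_submodule[OF f submodule_carrier Suc] by simp
qed

end

context fg_semisimple_module
begin

text \<open>Take \<open>n\<close> for which the length of \<open>f\<^sup>n(M)\<close> is minimal.\<close>

lemma funpow_image_stabilizes:
  assumes f: "f \<in> carrier (module_End R M)"
  shows "\<exists>n. f ` (f ^^ n) ` carrier M = (f ^^ n) ` carrier M"
proof -
  let ?I = "\<lambda>i. (f ^^ i) ` carrier M"
  have sub: "submodule (?I i) R M" for i using funpow_image_submodule[OF f] .
  have "\<forall>i. \<exists>n. composition_length (?I i) n" using composition_length_exists[OF sub] by blast
  then obtain l where l: "\<And>i. composition_length (?I i) (l i)" by metis
  obtain n where n: "\<And>i. l n \<le> l i"
    using ex_has_least_nat[of "\<lambda>_. True" 0 l] by auto
  have "?I (Suc n) \<subseteq> ?I n"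
    using EndD(1)[OF f] by (auto simp: funpow_swap1)
  then obtain m where m: "m \<le> l n" "composition_length (?I (Suc n)) m" "m = l n \<longrightarrow> ?I (Suc n) = ?I n"
    using composition_length_subset[OF l[of n] sub[of "Suc n"]] by blast
  have "m = l (Suc n)" using composition_length_unique[OF m(2) l] .
  then have "?I (Suc n) = ?I n" using m n[of "Suc n"] by simp
  then show ?thesis by (intro exI[of _ n]) (simp add: image_image)
qed

text \<open>By rank and nullity \<open>len V = len (V \<inter> ker f) + len V\<close>.\<close>

lemma trivial_kernel_if_surj_on_submodule:
  assumes f: "f \<in> carrier (module_End R M)" and V: "submodule V R M" and surj: "f ` V = V"
    and x: "x \<in> V" "f x = \<zero>\<^bsub>M\<^esub>"
  shows "x = \<zero>\<^bsub>M\<^esub>"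
proof -
  have "submodule {x \<in> V. f x = \<zero>\<^bsub>M\<^esub>} R M"
    using preimage_submodule[OF f V submodule_zero] by simp
  then obtain k v where k: "composition_length {x \<in> V. f x = \<zero>\<^bsub>M\<^esub>} k"
    and v: "composition_length V v"
    using composition_length_exists V by blast
  have "{x \<in> V. f x \<in> V} = V" using surj by blast
  then have "composition_length V (k + v)"
    using composition_length_preimage[OF f V k v] surj by simp
  then have "k = 0" using composition_length_unique[OF v] by fastforce
  then show ?thesis using composition_length_0 k x by blast
qed

text \<open>The exponent is \<open>n + 1\<close> rather than the \<open>n\<close> at which the images stabilize, so that \<open>W\<close> contains
  \<open>ker f\<close> even for \<open>n = 0\<close>.\<close>

lemma fitting_decomposition:
  assumes f: "f \<in> carrier (module_End R M)"
  shows "\<exists>V W n. direct_sum_of R M (carrier M) V W \<and> f ` V = V \<and>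
    W = {x \<in> carrier M. (f ^^ Suc n) x = \<zero>\<^bsub>M\<^esub>}"
proof -
  obtain n where n: "f ` (f ^^ n) ` carrier M = (f ^^ n) ` carrier M"
    using funpow_image_stabilizes[OF f] by blast
  define V where "V = (f ^^ n) ` carrier M"
  define W where "W = {x \<in> carrier M. (f ^^ Suc n) x = \<zero>\<^bsub>M\<^esub>}"
  have sub: "submodule V R M" "submodule W R M"
    unfolding V_def W_def using funpow_image_submodule[OF f] funpow_kernel_submodule[OF f] by blast+
  have fV: "f ` V = V" using n unfolding V_def .
  have pow: "(f ^^ i) ` V = V" for i
  proof (induction i)
    case (Suc i)
    have "(f ^^ Suc i) ` V = f ` (f ^^ i) ` V" by (simp add: image_image)
    then show ?case using Suc fV by simp
  qed simp
  have "x = \<zero>\<^bsub>M\<^esub>" if "x \<in> V" "(f ^^ i) x = \<zero>\<^bsub>M\<^esub>" for x i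
    using that
  proof (induction i arbitrary: x)
    case (Suc i)
    have "f x = \<zero>\<^bsub>M\<^esub>" using Suc.IH[of "f x"] Suc.prems fV by (auto simp: funpow_swap1)
    then show ?case using trivial_kernel_if_surj_on_submodule[OF f sub(1) fV] Suc.prems by blast
  qed simp
  then have int: "V \<inter> W = {\<zero>\<^bsub>M\<^esub>}"
    using submoduleD(2)[OF sub(1)] submoduleD(2)[OF sub(2)] unfolding W_def by blast
  have "x \<in> V <+>\<^bsub>M\<^esub> W" if x: "x \<in> carrier M" for x
  proof -
    \<comment> \<open>The power \<open>f\<^sup>n\<^sup>+\<^sup>1\<close> maps \<open>V\<close> onto itself, so \<open>x\<close> can be corrected by an element of \<open>V\<close>.\<close>
    have "(f ^^ Suc n) x \<in> V" using x fV unfolding V_def by auto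
    then obtain v where v: "v \<in> V" "(f ^^ Suc n) x = (f ^^ Suc n) v"
      using pow[of "Suc n"] by (metis imageE)
    have vc: "v \<in> carrier M" using v(1) submoduleD(5)[OF sub(1)] by blast
    have "(f ^^ Suc n) (x \<ominus>\<^bsub>M\<^esub> v) = \<zero>\<^bsub>M\<^esub>"
      using funpow_diff[OF f x vc] v(2) funpow_closed[OF f vc] by (metis M.minus_eq M.r_neg)
    then have "x \<ominus>\<^bsub>M\<^esub> v \<in> W" using x vc unfolding W_def by simp
    moreover have "x = v \<oplus>\<^bsub>M\<^esub> (x \<ominus>\<^bsub>M\<^esub> v)"
      using x vc M.a_lcomm[of v x "\<ominus>\<^bsub>M\<^esub> v"] by (simp add: M.minus_eq M.r_neg)
    ultimately show ?thesis using v(1) unfolding set_add_iff by blast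
  qed
  then have "carrier M = V <+>\<^bsub>M\<^esub> W"
    using submoduleD(1)[OF submodule_sum[OF sub]] by blast
  then show ?thesis
    using sub int fV W_def unfolding direct_sum_of_def by blast
qed

text \<open>Both sides complement \<open>len f(W)\<close> to \<open>len W\<close>: the left one because \<open>W = W\<^sub>1 \<oplus> f(W)\<close>, the right
  one by rank and nullity for \<open>f\<close> on \<open>W\<close>.\<close>

lemma semisimple_dim_complement_of_image:
  assumes f: "f \<in> carrier (module_End R M)" and W: "submodule W R M" and "a_kernel M M f \<subseteq> W"
    and sum: "direct_sum_of R M W W1 (f ` W)"
  shows "semisimple_dim R (M\<lparr>carrier := W1\<rparr>) = semisimple_dim R (M\<lparr>carrier := a_kernel M M f\<rparr>)"
proof -
  have ker: "a_kernel M M f = {x \<in> W. f x = \<zero>\<^bsub>M\<^esub>}"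
    using assms(3) submoduleD(1)[OF W] by (auto simp: a_kernel_def')
  have "submodule (a_kernel M M f) R M"
    unfolding a_kernel_eq by (rule preimage_submodule[OF f submodule_carrier submodule_zero])
  then obtain k where k: "composition_length (a_kernel M M f) k"
    using composition_length_exists by blast
  obtain a b where a: "composition_length W1 a" and b: "composition_length (f ` W) b"
    using sum composition_length_exists unfolding direct_sum_of_def by blast
  have "composition_length W (a + b)"
    using composition_length_direct_sum[OF b a] sum unfolding direct_sum_of_def by simp
  moreover have "composition_length {x \<in> W. f x \<in> f ` W} (k + b)"
    using k b unfolding ker by (rule composition_length_preimage[OF f W]) simp
  moreover have "{x \<in> W. f x \<in> f ` W} = W" by blast
  ultimately have "a = k" using composition_length_unique by fastforce
  then show ?thesis using semisimple_dim_eq a k by simp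
qed

end

section \<open>Endomorphism rings\<close>

context ring
begin

lemma additive_subgroup_of_subset:
  assumes "additive_subgroup I R" "additive_subgroup J R" "I \<subseteq> J"
  shows "additive_subgroup I (R\<lparr>carrier := J\<rparr>)"
  using add.subgroup_incl[of I J] assms unfolding additive_subgroup_def by simp

lemma nonunital_ring_of_additive_subgroup:
  assumes "additive_subgroup I R" "\<And>x y. \<lbrakk>x \<in> I; y \<in> I\<rbrakk> \<Longrightarrow> x \<otimes> y \<in> I"
  shows "nonunital_ring (R\<lparr>carrier := I\<rparr>)"
proof -
  interpret I: additive_subgroup I R by fact
  show ?thesis
  proof (intro nonunital_ring.intro nonunital_ring_axioms.intro)
    show "abelian_group (R\<lparr>carrier := I\<rparr>)"
    proof (rule abelian_groupI)
      fix x assume "x \<in> carrier (R\<lparr>carrier := I\<rparr>)"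
      then show "\<exists>y\<in>carrier (R\<lparr>carrier := I\<rparr>).
          y \<oplus>\<^bsub>R\<lparr>carrier := I\<rparr>\<^esub> x = \<zero>\<^bsub>R\<lparr>carrier := I\<rparr>\<^esub>"
        by (auto intro!: bexI[of _ "\<ominus> x"] simp: l_neg)
    qed (auto simp: a_assoc intro: a_comm)
  qed (auto simp: assms(2) m_assoc l_distr r_distr)
qed

text \<open>The set \<^const>\<open>Cen0\<close> is the two-sided annihilator of one element of an endomorphism ring. That it is
  a nonunital ring is a fact about arbitrary rings, and the next two lemmas are stated as such.\<close>

lemma two_sided_annihilator_additive_subgroup:
  assumes "a \<in> carrier R"
  shows "additive_subgroup {x \<in> carrier R. x \<otimes> a = \<zero> \<and> a \<otimes> x = \<zero>} R"
  by (intro additive_subgroup.intro add.subgroupI)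
    (use assms in \<open>auto simp: l_minus r_minus l_distr r_distr intro!: exI[of _ \<zero>]\<close>)

lemma two_sided_annihilator_mult:
  assumes "a \<in> carrier R" "x \<in> {x \<in> carrier R. x \<otimes> a = \<zero> \<and> a \<otimes> x = \<zero>}"
    "y \<in> {x \<in> carrier R. x \<otimes> a = \<zero> \<and> a \<otimes> x = \<zero>}"
  shows "x \<otimes> y \<in> {x \<in> carrier R. x \<otimes> a = \<zero> \<and> a \<otimes> x = \<zero>}"
  using assms by (simp add: m_assoc) (simp add: m_assoc [symmetric])

end

context left_module
begin

abbreviation E where "E \<equiv> module_End R M"

lemma End_zero: "\<zero>\<^bsub>E\<^esub> = (\<lambda>x\<in>carrier M. \<zero>\<^bsub>M\<^esub>)"
  and End_one: "\<one>\<^bsub>E\<^esub> = (\<lambda>x\<in>carrier M. x)"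
  and End_add: "f \<oplus>\<^bsub>E\<^esub> g = (\<lambda>x\<in>carrier M. f x \<oplus>\<^bsub>M\<^esub> g x)"
  and End_mult: "f \<otimes>\<^bsub>E\<^esub> g = (\<lambda>x\<in>carrier M. f (g x))"
  by (simp_all add: module_End_def compose_def)

lemma End_eqI:
  assumes "f \<in> carrier E" "g \<in> carrier E" "\<And>x. x \<in> carrier M \<Longrightarrow> f x = g x"
  shows "f = g"
  using EndD(4)[OF assms(1)] EndD(4)[OF assms(2)] assms(3) by (rule extensionalityI)

lemma End_zero_closed: "\<zero>\<^bsub>E\<^esub> \<in> carrier E"
  and End_one_closed: "\<one>\<^bsub>E\<^esub> \<in> carrier E"
  and End_add_closed: "f \<in> carrier E \<Longrightarrow> g \<in> carrier E \<Longrightarrow> f \<oplus>\<^bsub>E\<^esub> g \<in> carrier E"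
  and End_mult_closed: "f \<in> carrier E \<Longrightarrow> g \<in> carrier E \<Longrightarrow> f \<otimes>\<^bsub>E\<^esub> g \<in> carrier E"
  and End_minus_closed: "f \<in> carrier E \<Longrightarrow> (\<lambda>x\<in>carrier M. \<ominus>\<^bsub>M\<^esub> f x) \<in> carrier E"
  unfolding End_zero End_one End_add End_mult End_carrier_iff
  by (auto simp: smult_zero_right smult_minus_right smult_r_distr M.a_ac M.minus_add image_subset_iff)

lemma ring_End: "ring E"
proof (rule ringI)
  note closed = End_zero_closed End_one_closed End_add_closed End_mult_closed
  show "abelian_group E"
  proof (rule abelian_groupI)
    fix f g h assume fgh: "f \<in> carrier E" "g \<in> carrier E" "h \<in> carrier E"
    show "f \<oplus>\<^bsub>E\<^esub> g \<oplus>\<^bsub>E\<^esub> h = f \<oplus>\<^bsub>E\<^esub> (g \<oplus>\<^bsub>E\<^esub> h)"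
      by (rule End_eqI) (simp_all add: fgh closed, simp add: End_add EndD(1) fgh M.a_assoc)
  next
    fix f g assume fg: "f \<in> carrier E" "g \<in> carrier E"
    show "f \<oplus>\<^bsub>E\<^esub> g = g \<oplus>\<^bsub>E\<^esub> f"
      by (rule End_eqI) (simp_all add: fg closed, simp add: End_add EndD(1) fg M.a_comm)
  next
    fix f assume f: "f \<in> carrier E"
    show "\<zero>\<^bsub>E\<^esub> \<oplus>\<^bsub>E\<^esub> f = f"
      by (rule End_eqI) (simp_all add: f closed, simp add: End_add End_zero EndD(1) f)
    have "(\<lambda>x\<in>carrier M. \<ominus>\<^bsub>M\<^esub> f x) \<oplus>\<^bsub>E\<^esub> f = \<zero>\<^bsub>E\<^esub>"
      by (rule End_eqI)
        (simp_all add: f closed End_minus_closed, simp add: End_add End_zero EndD(1) f M.l_neg)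
    then show "\<exists>g\<in>carrier E. g \<oplus>\<^bsub>E\<^esub> f = \<zero>\<^bsub>E\<^esub>"
      using End_minus_closed[OF f] by blast
  qed (simp_all add: closed)
  show "monoid E"
  proof (rule monoidI)
    fix f g h assume fgh: "f \<in> carrier E" "g \<in> carrier E" "h \<in> carrier E"
    show "f \<otimes>\<^bsub>E\<^esub> g \<otimes>\<^bsub>E\<^esub> h = f \<otimes>\<^bsub>E\<^esub> (g \<otimes>\<^bsub>E\<^esub> h)"
      by (rule End_eqI) (simp_all add: fgh closed, simp add: End_mult EndD(1) fgh)
  next
    fix f assume f: "f \<in> carrier E"
    show "\<one>\<^bsub>E\<^esub> \<otimes>\<^bsub>E\<^esub> f = f"
      by (rule End_eqI) (simp_all add: f closed, simp add: End_mult End_one EndD(1) f)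
    show "f \<otimes>\<^bsub>E\<^esub> \<one>\<^bsub>E\<^esub> = f"
      by (rule End_eqI) (simp_all add: f closed, simp add: End_mult End_one EndD(1) f)
  qed (simp_all add: closed)
  fix f g h assume fgh: "f \<in> carrier E" "g \<in> carrier E" "h \<in> carrier E"
  show "(f \<oplus>\<^bsub>E\<^esub> g) \<otimes>\<^bsub>E\<^esub> h = f \<otimes>\<^bsub>E\<^esub> h \<oplus>\<^bsub>E\<^esub> g \<otimes>\<^bsub>E\<^esub> h"
    by (rule End_eqI) (simp_all add: fgh closed, simp add: End_mult End_add EndD(1) fgh)
  show "h \<otimes>\<^bsub>E\<^esub> (f \<oplus>\<^bsub>E\<^esub> g) = h \<otimes>\<^bsub>E\<^esub> f \<oplus>\<^bsub>E\<^esub> h \<otimes>\<^bsub>E\<^esub> g"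
    by (rule End_eqI) (simp_all add: fgh closed, simp add: End_mult End_add EndD(1,2) fgh)
qed

lemma End_a_inv:
  assumes f: "f \<in> carrier E"
  shows "\<ominus>\<^bsub>E\<^esub> f = (\<lambda>x\<in>carrier M. \<ominus>\<^bsub>M\<^esub> f x)"
proof -
  interpret E: ring E by (rule ring_End)
  have "(\<lambda>x\<in>carrier M. \<ominus>\<^bsub>M\<^esub> f x) \<oplus>\<^bsub>E\<^esub> f = \<zero>\<^bsub>E\<^esub>"
    by (rule End_eqI)
      (simp_all add: f End_minus_closed, simp add: End_add End_zero EndD(1) f M.l_neg)
  then show ?thesis using f End_minus_closed[OF f] by (rule E.minus_equality)
qed

text \<open>The rings in which the zero-level centralizer of \<open>f|W\<close> is a one-sided ideal are defined by the preservation of one or two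
  submodules, so they are stabilizers or intersections of stabilizers.\<close>

lemma stabilizer_subring:
  assumes N: "submodule N R M"
  shows "subring {\<alpha> \<in> carrier E. \<alpha> ` N \<subseteq> N} E"
proof -
  interpret E: ring E by (rule ring_End)
  have N': "x \<in> carrier M" if "x \<in> N" for x using submoduleD(5)[OF N that] .
  show ?thesis
  proof (rule E.subringI)
    show "\<ominus>\<^bsub>E\<^esub> h \<in> {\<alpha> \<in> carrier E. \<alpha> ` N \<subseteq> N}" if "h \<in> {\<alpha> \<in> carrier E. \<alpha> ` N \<subseteq> N}" for h
    proof -
      have "\<ominus>\<^bsub>M\<^esub> h x \<in> N" if "x \<in> N" for x
        using that \<open>h \<in> _\<close> submodule_minus[OF N] by blast
      then show ?thesis using that N' by (auto simp: End_a_inv End_minus_closed)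
    qed
    show "g \<oplus>\<^bsub>E\<^esub> h \<in> {\<alpha> \<in> carrier E. \<alpha> ` N \<subseteq> N}"
      if "g \<in> {\<alpha> \<in> carrier E. \<alpha> ` N \<subseteq> N}" "h \<in> {\<alpha> \<in> carrier E. \<alpha> ` N \<subseteq> N}" for g h
    proof -
      have "g x \<oplus>\<^bsub>M\<^esub> h x \<in> N" if "x \<in> N" for x
        using that \<open>g \<in> _\<close> \<open>h \<in> _\<close> submoduleD(3)[OF N] by blast
      then show ?thesis using that N' End_add_closed[of g h] by (auto simp: End_add)
    qed
    show "g \<otimes>\<^bsub>E\<^esub> h \<in> {\<alpha> \<in> carrier E. \<alpha> ` N \<subseteq> N}"
      if "g \<in> {\<alpha> \<in> carrier E. \<alpha> ` N \<subseteq> N}" "h \<in> {\<alpha> \<in> carrier E. \<alpha> ` N \<subseteq> N}" for g h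
      using that N' End_mult_closed[of g h] by (auto simp: End_mult image_subset_iff)
    show "\<one>\<^bsub>E\<^esub> \<in> {\<alpha> \<in> carrier E. \<alpha> ` N \<subseteq> N}"
      using N' End_one_closed by (auto simp: End_one)
  qed auto
qed

lemma Cen0_iff:
  assumes f: "f \<in> carrier E"
  shows "\<psi> \<in> Cen0 R M f \<longleftrightarrow> \<psi> \<in> carrier E \<and> (\<forall>x\<in>carrier M. \<psi> (f x) = \<zero>\<^bsub>M\<^esub>) \<and>
    (\<forall>x\<in>carrier M. f (\<psi> x) = \<zero>\<^bsub>M\<^esub>)"
  by (auto simp: Cen0_def End_mult End_zero fun_eq_iff restrict_def)

lemma Cen0_additive_subgroup:
  assumes "f \<in> carrier E"
  shows "additive_subgroup (Cen0 R M f) E"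
  unfolding Cen0_def by (rule ring.two_sided_annihilator_additive_subgroup[OF ring_End assms])

lemma nonunital_ring_Cen0:
  assumes "f \<in> carrier E"
  shows "nonunital_ring (E\<lparr>carrier := Cen0 R M f\<rparr>)"
  using Cen0_additive_subgroup[OF assms] ring.two_sided_annihilator_mult[OF ring_End assms]
  by (intro ring.nonunital_ring_of_additive_subgroup[OF ring_End]) (auto simp: Cen0_def)

lemma restrict_End:
  assumes f: "f \<in> carrier E" and W: "submodule W R M" "f ` W \<subseteq> W"
  shows "restrict f W \<in> carrier (module_End R (M\<lparr>carrier := W\<rparr>))"
  using submoduleD[OF W(1)] W(2) EndD[OF f]
  unfolding left_module.End_carrier_iff[OF left_module_submodule[OF W(1)]] by auto

text \<open>The projection onto \<open>W\<close> along \<open>V\<close>, well defined because the decomposition of an element is unique.\<close>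

lemma projection_exists:
  assumes "direct_sum_of R M (carrier M) V W"
  shows "\<exists>\<pi>\<in>carrier E. \<pi> ` carrier M \<subseteq> W \<and> (\<forall>v\<in>V. \<pi> v = \<zero>\<^bsub>M\<^esub>) \<and> (\<forall>w\<in>W. \<pi> w = w)"
proof -
  have V: "submodule V R M" and W: "submodule W R M" and sum: "carrier M = V <+>\<^bsub>M\<^esub> W"
    and int: "V \<inter> W = {\<zero>\<^bsub>M\<^esub>}"
    using assms unfolding direct_sum_of_def by auto
  note Vc = submoduleD[OF V] and Wc = submoduleD[OF W]
  define \<pi> where "\<pi> = (\<lambda>x\<in>carrier M. THE w. w \<in> W \<and> (\<exists>v\<in>V. x = v \<oplus>\<^bsub>M\<^esub> w))"
  have unique: "w = w'" if "v \<in> V" "w \<in> W" "v' \<in> V" "w' \<in> W" "v \<oplus>\<^bsub>M\<^esub> w = v' \<oplus>\<^bsub>M\<^esub> w'" for v w v' w'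
  proof -
    have carr: "v \<in> carrier M" "w \<in> carrier M" "v' \<in> carrier M" "w' \<in> carrier M"
      using that Vc(5) Wc(5) by auto
    have "w = \<ominus>\<^bsub>M\<^esub> v \<oplus>\<^bsub>M\<^esub> (v' \<oplus>\<^bsub>M\<^esub> w')"
      using M.r_neg1[of v w] carr that(5) by simp
    then have "w \<ominus>\<^bsub>M\<^esub> w' = \<ominus>\<^bsub>M\<^esub> v \<oplus>\<^bsub>M\<^esub> v'"
      using carr by (simp add: M.minus_eq M.a_assoc M.r_neg)
    moreover have "w \<ominus>\<^bsub>M\<^esub> w' \<in> W" using submodule_diff[OF W] that by simp
    moreover have "\<ominus>\<^bsub>M\<^esub> v \<oplus>\<^bsub>M\<^esub> v' \<in> V" using Vc(3) submodule_minus[OF V] that by simp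
    ultimately have "w \<ominus>\<^bsub>M\<^esub> w' = \<zero>\<^bsub>M\<^esub>" using int by auto
    moreover have "w = (w \<ominus>\<^bsub>M\<^esub> w') \<oplus>\<^bsub>M\<^esub> w'"
      using carr by (simp add: M.minus_eq M.a_assoc M.l_neg)
    ultimately show "w = w'" using carr by simp
  qed
  have eval: "\<pi> (v \<oplus>\<^bsub>M\<^esub> w) = w" if "v \<in> V" "w \<in> W" for v w
  proof -
    have "(THE u. u \<in> W \<and> (\<exists>y\<in>V. v \<oplus>\<^bsub>M\<^esub> w = y \<oplus>\<^bsub>M\<^esub> u)) = w"
      using that unique by (intro the_equality) blast+
    then show ?thesis unfolding \<pi>_def using that Vc(5) Wc(5) by simp
  qed
  have decomp: "\<exists>v\<in>V. \<exists>w\<in>W. x = v \<oplus>\<^bsub>M\<^esub> w" if "x \<in> carrier M" for x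
    using that sum set_add_iff[of x V W] by blast
  have img: "\<pi> x \<in> W" if "x \<in> carrier M" for x
    using decomp[OF that] eval by auto
  have "\<pi> (x \<oplus>\<^bsub>M\<^esub> y) = \<pi> x \<oplus>\<^bsub>M\<^esub> \<pi> y" if xy: "x \<in> carrier M" "y \<in> carrier M" for x y
  proof -
    obtain v w where x: "v \<in> V" "w \<in> W" "x = v \<oplus>\<^bsub>M\<^esub> w" using decomp[OF xy(1)] by blast
    obtain v' w' where y: "v' \<in> V" "w' \<in> W" "y = v' \<oplus>\<^bsub>M\<^esub> w'" using decomp[OF xy(2)] by blast
    have "x \<oplus>\<^bsub>M\<^esub> y = (v \<oplus>\<^bsub>M\<^esub> v') \<oplus>\<^bsub>M\<^esub> (w \<oplus>\<^bsub>M\<^esub> w')"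
      using x y Vc(5) Wc(5) by (simp add: M.a_ac)
    then show ?thesis using eval x y Vc(3) Wc(3) by simp
  qed
  moreover have "\<pi> (a \<odot>\<^bsub>M\<^esub> x) = a \<odot>\<^bsub>M\<^esub> \<pi> x" if a: "a \<in> carrier R" and x: "x \<in> carrier M" for a x
  proof -
    obtain v w where vw: "v \<in> V" "w \<in> W" "x = v \<oplus>\<^bsub>M\<^esub> w" using decomp[OF x] by blast
    have "a \<odot>\<^bsub>M\<^esub> x = a \<odot>\<^bsub>M\<^esub> v \<oplus>\<^bsub>M\<^esub> a \<odot>\<^bsub>M\<^esub> w"
      using vw a Vc(5) Wc(5) by (simp add: smult_r_distr)
    then show ?thesis using eval vw a Vc(4) Wc(4) by simp
  qed
  moreover have "\<pi> \<in> extensional (carrier M)" unfolding \<pi>_def by simp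
  ultimately have "\<pi> \<in> carrier E"
    using img Wc(5) unfolding End_carrier_iff by blast
  moreover have "\<pi> v = \<zero>\<^bsub>M\<^esub>" if "v \<in> V" for v
    using eval[OF that Wc(2)] Vc(5)[OF that] by simp
  moreover have "\<pi> w = w" if "w \<in> W" for w
    using eval[OF Vc(2) that] Wc(5)[OF that] by simp
  ultimately show ?thesis using img by blast
qed

text \<open>An element of the zero-level centralizer kills \<open>V = f(V)\<close> and maps into \<open>ker f \<subseteq> W\<close>. The first fact
  makes restriction to \<open>W\<close> injective, the second makes it land in the endomorphisms of \<open>W\<close> and
  respect composition. The inverse is composition with the projection onto \<open>W\<close>.\<close>

lemma Cen0_restrict_isomorphic:
  assumes f: "f \<in> carrier E" and sum: "direct_sum_of R M (carrier M) V W"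
    and fV: "f ` V = V" and fW: "f ` W \<subseteq> W" and ker: "a_kernel M M f \<subseteq> W"
  shows "nonunital_ring_isomorphic (E\<lparr>carrier := Cen0 R M f\<rparr>)
    ((module_End R (M\<lparr>carrier := W\<rparr>))\<lparr>carrier := Cen0 R (M\<lparr>carrier := W\<rparr>) (restrict f W)\<rparr>)"
proof -
  have V: "submodule V R M" and W: "submodule W R M" and eq: "carrier M = V <+>\<^bsub>M\<^esub> W"
    using sum unfolding direct_sum_of_def by auto
  note Vc = submoduleD[OF V] and Wc = submoduleD[OF W]
  interpret W: left_module R "M\<lparr>carrier := W\<rparr>" by (rule left_module_submodule[OF W])
  have fR: "restrict f W \<in> carrier (module_End R (M\<lparr>carrier := W\<rparr>))"
    by (rule restrict_End[OF f W fW])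
  obtain \<pi> where \<pi>: "\<pi> \<in> carrier E" "\<And>x. x \<in> carrier M \<Longrightarrow> \<pi> x \<in> W"
      "\<And>v. v \<in> V \<Longrightarrow> \<pi> v = \<zero>\<^bsub>M\<^esub>" "\<And>w. w \<in> W \<Longrightarrow> \<pi> w = w"
    using projection_exists[OF sum] by blast
  have decomp: "\<exists>v\<in>V. \<exists>w\<in>W. x = v \<oplus>\<^bsub>M\<^esub> w" if "x \<in> carrier M" for x
    using that eq set_add_iff[of x V W] by blast
  have Cen: "\<psi> \<in> carrier E" "\<And>v. v \<in> V \<Longrightarrow> \<psi> v = \<zero>\<^bsub>M\<^esub>" "\<And>x. x \<in> carrier M \<Longrightarrow> \<psi> x \<in> W"
      "\<And>x. x \<in> carrier M \<Longrightarrow> f (\<psi> x) = \<zero>\<^bsub>M\<^esub>" "\<And>x. x \<in> carrier M \<Longrightarrow> \<psi> (f x) = \<zero>\<^bsub>M\<^esub>"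
    if "\<psi> \<in> Cen0 R M f" for \<psi>
  proof -
    show \<psi>: "\<psi> \<in> carrier E" and 0: "\<And>x. x \<in> carrier M \<Longrightarrow> f (\<psi> x) = \<zero>\<^bsub>M\<^esub>"
      "\<And>x. x \<in> carrier M \<Longrightarrow> \<psi> (f x) = \<zero>\<^bsub>M\<^esub>"
      using that unfolding Cen0_iff[OF f] by auto
    show "\<psi> v = \<zero>\<^bsub>M\<^esub>" if "v \<in> V" for v
      using that fV 0(2) Vc(5) by (metis imageE)
    show "\<psi> x \<in> W" if "x \<in> carrier M" for x
      using 0(1)[OF that] EndD(1)[OF \<psi> that] ker by (auto simp: a_kernel_def')
  qed
  have "bij_betw (\<lambda>\<psi>. restrict \<psi> W) (Cen0 R M f) (Cen0 R (M\<lparr>carrier := W\<rparr>) (restrict f W))"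
    unfolding bij_betw_def
  proof (intro conjI inj_onI equalityI subsetI)
    fix \<psi> \<chi> assume *: "\<psi> \<in> Cen0 R M f" "\<chi> \<in> Cen0 R M f" "restrict \<psi> W = restrict \<chi> W"
    show "\<psi> = \<chi>"
    proof (rule End_eqI)
      show "\<psi> \<in> carrier E" "\<chi> \<in> carrier E" using Cen(1) * by auto
      fix x assume "x \<in> carrier M"
      then obtain v w where vw: "v \<in> V" "w \<in> W" "x = v \<oplus>\<^bsub>M\<^esub> w" using decomp by blast
      have "\<psi> w = \<chi> w" using *(3) vw(2) by (metis restrict_apply')
      then show "\<psi> x = \<chi> x"
        using vw Vc(5) Wc(5) EndD(2)[OF Cen(1)[OF *(1)], of v w] EndD(2)[OF Cen(1)[OF *(2)], of v w]
          Cen(2)[OF *(1)] Cen(2)[OF *(2)] by simp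
    qed
  next
    fix \<theta> assume "\<theta> \<in> (\<lambda>\<psi>. restrict \<psi> W) ` Cen0 R M f"
    then obtain \<psi> where \<psi>: "\<psi> \<in> Cen0 R M f" "\<theta> = restrict \<psi> W" by blast
    have "\<psi> ` W \<subseteq> W" using Cen(3)[OF \<psi>(1)] Wc(5) by blast
    then show "\<theta> \<in> Cen0 R (M\<lparr>carrier := W\<rparr>) (restrict f W)"
      using restrict_End[OF Cen(1)[OF \<psi>(1)] W] fW Cen(4,5)[OF \<psi>(1)] Wc(5)
      unfolding W.Cen0_iff[OF fR] \<psi>(2) by (auto simp: image_subset_iff)
  next
    fix \<theta> assume "\<theta> \<in> Cen0 R (M\<lparr>carrier := W\<rparr>) (restrict f W)"
    then have \<theta>: "\<theta> \<in> carrier (module_End R (M\<lparr>carrier := W\<rparr>))"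
        "\<And>w. w \<in> W \<Longrightarrow> \<theta> (f w) = \<zero>\<^bsub>M\<^esub>" "\<And>w. w \<in> W \<Longrightarrow> f (\<theta> w) = \<zero>\<^bsub>M\<^esub>"
      using W.EndD(1) unfolding W.Cen0_iff[OF fR] by auto
    note \<theta>W = W.EndD[OF \<theta>(1), simplified]
    let ?\<psi> = "\<lambda>x\<in>carrier M. \<theta> (\<pi> x)"
    have E: "?\<psi> \<in> carrier E"
      unfolding End_carrier_iff using \<theta>W \<pi>(2) EndD[OF \<pi>(1)] Wc(5) by auto
    have "\<theta> (\<pi> (f x)) = \<zero>\<^bsub>M\<^esub>" if "x \<in> carrier M" for x
    proof -
      obtain v w where vw: "v \<in> V" "w \<in> W" "x = v \<oplus>\<^bsub>M\<^esub> w" using decomp \<open>x \<in> _\<close> by blast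
      have fvw: "f v \<in> V" "f w \<in> W" using vw fV fW by auto
      \<comment> \<open>The projection commutes with \<open>f\<close>, since \<open>f\<close> preserves both summands.\<close>
      have "\<pi> (f x) = f w"
        using vw fvw EndD(2)[OF f, of v w] EndD(2)[OF \<pi>(1), of "f v" "f w"] \<pi>(3,4) Vc(5) Wc(5) by simp
      then show ?thesis using \<theta>(2) vw by simp
    qed
    then have "?\<psi> \<in> Cen0 R M f"
      unfolding Cen0_iff[OF f] using E \<theta>(3) \<pi>(2) EndD(1)[OF f] by simp
    moreover have "\<theta> = restrict ?\<psi> W"
      using \<theta>W(4) \<pi>(4) Wc(5) by (auto intro!: extensionalityI[of _ W])
    ultimately show "\<theta> \<in> (\<lambda>\<psi>. restrict \<psi> W) ` Cen0 R M f" by blast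
  qed
  moreover have "restrict (\<psi> \<oplus>\<^bsub>E\<^esub> \<chi>) W = restrict \<psi> W \<oplus>\<^bsub>module_End R (M\<lparr>carrier := W\<rparr>)\<^esub> restrict \<chi> W"
    for \<psi> \<chi>
    using Wc(5) by (auto simp: End_add W.End_add fun_eq_iff)
  moreover have "restrict (\<psi> \<otimes>\<^bsub>E\<^esub> \<chi>) W = restrict \<psi> W \<otimes>\<^bsub>module_End R (M\<lparr>carrier := W\<rparr>)\<^esub> restrict \<chi> W"
    if "\<chi> \<in> Cen0 R M f" for \<psi> \<chi>
    using Wc(5) Cen(3)[OF that] by (auto simp: End_mult W.End_mult fun_eq_iff)
  ultimately show ?thesis
    unfolding nonunital_ring_isomorphic_def
    using nonunital_ring_Cen0[OF f] W.nonunital_ring_Cen0[OF fR]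
    by (auto intro!: exI[of _ "\<lambda>\<psi>. restrict \<psi> W"])
qed

text \<open>The two annihilation conditions say that \<open>\<theta>\<close> kills \<open>f(W)\<close> and maps \<open>W\<close> into \<open>ker f\<close>. Given the first,
  the second has to be checked on the complement \<open>W\<^sub>1\<close> only.\<close>

lemma Cen0_restrict_eq:
  assumes f: "f \<in> carrier E" and W: "submodule W R M"
    and ker: "a_kernel M M f \<subseteq> W" and sum: "direct_sum_of R M W W1 (f ` W)"
  shows "Cen0 R (M\<lparr>carrier := W\<rparr>) (restrict f W) =
    {\<theta> \<in> carrier (module_End R (M\<lparr>carrier := W\<rparr>)).
       \<theta> ` W1 \<subseteq> a_kernel M M f \<and> \<theta> ` f ` W = {\<zero>\<^bsub>M\<^esub>}}"
proof -
  interpret W: left_module R "M\<lparr>carrier := W\<rparr>" by (rule left_module_submodule[OF W])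
  have W1: "submodule W1 R M" and W2: "submodule (f ` W) R M" and eq: "W = W1 <+>\<^bsub>M\<^esub> (f ` W)"
    using sum unfolding direct_sum_of_def by auto
  have sub: "W1 \<subseteq> W" "f ` W \<subseteq> W"
    using sum_upper1[OF W1 W2] sum_upper2[OF W1 W2] eq by auto
  have fR: "restrict f W \<in> carrier (module_End R (M\<lparr>carrier := W\<rparr>))"
    by (rule restrict_End[OF f W sub(2)])
  note Wc = submoduleD[OF W]
  have main: "(\<forall>x\<in>W. \<theta> (restrict f W x) = \<zero>\<^bsub>M\<^esub>) \<and> (\<forall>x\<in>W. restrict f W (\<theta> x) = \<zero>\<^bsub>M\<^esub>) \<longleftrightarrow>
      \<theta> ` W1 \<subseteq> a_kernel M M f \<and> \<theta> ` f ` W = {\<zero>\<^bsub>M\<^esub>}"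
    if \<theta>: "\<theta> \<in> carrier (module_End R (M\<lparr>carrier := W\<rparr>))" for \<theta>
  proof -
    note \<theta>W = W.EndD[OF \<theta>, simplified]
    have ker_iff: "f (\<theta> x) = \<zero>\<^bsub>M\<^esub> \<longleftrightarrow> \<theta> x \<in> a_kernel M M f" if "x \<in> W" for x
      using \<theta>W(1)[OF that] Wc(5) by (auto simp: a_kernel_def')
    have "\<theta> ` f ` W = {\<zero>\<^bsub>M\<^esub>} \<longleftrightarrow> (\<forall>x\<in>W. \<theta> (f x) = \<zero>\<^bsub>M\<^esub>)"
      using Wc(2) by (auto simp: image_image image_iff intro!: bexI[of _ "\<zero>\<^bsub>M\<^esub>"])
    moreover have "\<theta> x \<in> a_kernel M M f"
      if *: "\<theta> ` W1 \<subseteq> a_kernel M M f" "\<forall>x\<in>W. \<theta> (f x) = \<zero>\<^bsub>M\<^esub>" "x \<in> W" for x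
    proof -
      obtain w y where wy: "w \<in> W1" "y \<in> W" "x = w \<oplus>\<^bsub>M\<^esub> f y"
        using *(3) eq set_add_iff[of x W1 "f ` W"] by auto
      have "w \<in> W" "f y \<in> W" using wy sub by auto
      then have "\<theta> x = \<theta> w"
        using \<theta>W(1,2) wy *(2) Wc(5)[OF \<theta>W(1)[of w]] by simp
      then show ?thesis using *(1) wy(1) by auto
    qed
    ultimately show ?thesis
      using ker_iff \<theta>W(1) sub(1) by (auto simp: image_subset_iff)
  qed
  have Cen: "\<theta> \<in> Cen0 R (M\<lparr>carrier := W\<rparr>) (restrict f W) \<longleftrightarrow>
      \<theta> \<in> carrier (module_End R (M\<lparr>carrier := W\<rparr>)) \<and>
      ((\<forall>x\<in>W. \<theta> (restrict f W x) = \<zero>\<^bsub>M\<^esub>) \<and> (\<forall>x\<in>W. restrict f W (\<theta> x) = \<zero>\<^bsub>M\<^esub>))" for \<theta>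
    by (simp only: W.Cen0_iff[OF fR]) simp
  show ?thesis
    by (rule Set.set_eqI) (simp only: Cen mem_Collect_eq main cong: conj_cong)
qed

lemma restrict_nat_pow:
  assumes f: "f \<in> carrier E" and W: "submodule W R M" and fW: "f ` W \<subseteq> W"
  shows "x \<in> W \<Longrightarrow> (restrict f W [^]\<^bsub>module_End R (M\<lparr>carrier := W\<rparr>)\<^esub> k) x = (f ^^ k) x"
proof (induction k arbitrary: x)
  interpret W: left_module R "M\<lparr>carrier := W\<rparr>" by (rule left_module_submodule[OF W])
  interpret EW: ring "module_End R (M\<lparr>carrier := W\<rparr>)" by (rule W.ring_End)
  case 0
  then show ?case by (simp add: W.End_one)
next
  interpret W: left_module R "M\<lparr>carrier := W\<rparr>" by (rule left_module_submodule[OF W])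
  interpret EW: ring "module_End R (M\<lparr>carrier := W\<rparr>)" by (rule W.ring_End)
  case (Suc k)
  then have "f x \<in> W" using fW by blast
  with Suc show ?case by (simp add: W.End_mult funpow_swap1)
qed

lemma Cen0_restrict_into_kernel:
  assumes f: "f \<in> carrier E" and W: "submodule W R M" and fW: "f ` W \<subseteq> W"
    and \<theta>: "\<theta> \<in> Cen0 R (M\<lparr>carrier := W\<rparr>) (restrict f W)" and x: "x \<in> W"
  shows "\<theta> x \<in> a_kernel M M f"
proof -
  interpret W: left_module R "M\<lparr>carrier := W\<rparr>" by (rule left_module_submodule[OF W])
  show ?thesis
    using \<theta> x W.EndD(1)[of \<theta> x] submoduleD(5)[OF W]
    unfolding W.Cen0_iff[OF restrict_End[OF f W fW]] by (auto simp: a_kernel_def')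
qed

text \<open>If \<open>\<alpha>\<close> preserves \<open>ker f\<close>, then \<open>\<alpha>\<theta>\<close> still maps into \<open>ker f\<close>, and it kills whatever \<open>\<theta>\<close> kills.\<close>

lemma Cen0_restrict_left_ideal:
  assumes f: "f \<in> carrier E" and W: "submodule W R M"
    and ker: "a_kernel M M f \<subseteq> W" and fW: "f ` W \<subseteq> W"
  shows "left_ideal (Cen0 R (M\<lparr>carrier := W\<rparr>) (restrict f W))
    ((module_End R (M\<lparr>carrier := W\<rparr>))\<lparr>carrier :=
       {\<alpha> \<in> carrier (module_End R (M\<lparr>carrier := W\<rparr>)). \<alpha> ` a_kernel M M f \<subseteq> a_kernel M M f}\<rparr>)"
proof -
  let ?K = "a_kernel M M f"
  interpret W: left_module R "M\<lparr>carrier := W\<rparr>" by (rule left_module_submodule[OF W])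
  interpret EW: ring "module_End R (M\<lparr>carrier := W\<rparr>)" by (rule W.ring_End)
  let ?E1 = "{\<alpha> \<in> carrier (module_End R (M\<lparr>carrier := W\<rparr>)). \<alpha> ` ?K \<subseteq> ?K}"
  let ?T = "Cen0 R (M\<lparr>carrier := W\<rparr>) (restrict f W)"
  have fR: "restrict f W \<in> carrier (module_End R (M\<lparr>carrier := W\<rparr>))"
    by (rule restrict_End[OF f W fW])
  have K: "submodule ?K R M"
    unfolding a_kernel_eq by (rule preimage_submodule[OF f submodule_carrier submodule_zero])
  have sub: "subring ?E1 (module_End R (M\<lparr>carrier := W\<rparr>))"
    using K ker submodule_of_submodule_iff[OF W] by (intro W.stabilizer_subring) simp
  have TK: "\<theta> x \<in> ?K" if "\<theta> \<in> ?T" "x \<in> W" for \<theta> x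
    using Cen0_restrict_into_kernel[OF f W fW that] .
  have T1: "?T \<subseteq> ?E1"
  proof
    fix \<theta> assume \<theta>: "\<theta> \<in> ?T"
    then have "\<theta> \<in> carrier (module_End R (M\<lparr>carrier := W\<rparr>))" unfolding W.Cen0_iff[OF fR] by simp
    moreover have "\<theta> ` ?K \<subseteq> ?K" using TK[OF \<theta>] ker by blast
    ultimately show "\<theta> \<in> ?E1" by simp
  qed
  have "\<alpha> \<otimes>\<^bsub>module_End R (M\<lparr>carrier := W\<rparr>)\<^esub> \<theta> \<in> ?T" if "\<theta> \<in> ?T" "\<alpha> \<in> ?E1" for \<alpha> \<theta>
  proof -
    have \<theta>: "\<theta> \<in> carrier (module_End R (M\<lparr>carrier := W\<rparr>))" "\<And>x. x \<in> W \<Longrightarrow> \<theta> (f x) = \<zero>\<^bsub>M\<^esub>"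
      using that(1) unfolding W.Cen0_iff[OF fR] by auto
    have "\<alpha> (\<theta> x) \<in> ?K" if "x \<in> W" for x
      using TK[OF \<open>\<theta> \<in> ?T\<close> that] \<open>\<alpha> \<in> ?E1\<close> by blast
    then have "f (\<alpha> (\<theta> x)) = \<zero>\<^bsub>M\<^esub>" "\<alpha> (\<theta> x) \<in> W" if "x \<in> W" for x
      using that ker by (auto simp: a_kernel_def')
    then show ?thesis
      using W.End_mult_closed[OF _ \<theta>(1), of \<alpha>] that(2) \<theta>(2) fW W.End_apply_zero[of \<alpha>]
      unfolding W.Cen0_iff[OF fR] by (auto simp: W.End_mult image_subset_iff)
  qed
  then show ?thesis
    using EW.additive_subgroup_of_subset[OF W.Cen0_additive_subgroup[OF fR] _ T1] subring.axioms(1)[OF sub]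
      EW.subring_is_ring[OF sub]
    by (intro left_ideal.intro left_ideal_axioms.intro) (auto simp: additive_subgroup_def)
qed

text \<open>If \<open>\<alpha>\<close> preserves \<open>f(W)\<close>, then \<open>\<theta>\<alpha>\<close> still kills \<open>f(W)\<close>, and its image lies in that of \<open>\<theta>\<close>. The
  centralizer is contained in the larger ring because its elements map \<open>W\<close> into
  \<open>ker f \<subseteq> W\<^sub>1 + ker f\<close> and kill \<open>f(W)\<close>.\<close>

lemma Cen0_restrict_right_ideal:
  assumes f: "f \<in> carrier E" and W: "submodule W R M"
    and ker: "a_kernel M M f \<subseteq> W" and W1: "submodule W1 R M" "W1 \<subseteq> W" and fW: "f ` W \<subseteq> W"
  shows "right_ideal (Cen0 R (M\<lparr>carrier := W\<rparr>) (restrict f W))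
    ((module_End R (M\<lparr>carrier := W\<rparr>))\<lparr>carrier :=
       {\<alpha> \<in> carrier (module_End R (M\<lparr>carrier := W\<rparr>)).
          \<alpha> ` (W1 <+>\<^bsub>M\<^esub> a_kernel M M f) \<subseteq> W1 <+>\<^bsub>M\<^esub> a_kernel M M f \<and> \<alpha> ` f ` W \<subseteq> f ` W}\<rparr>)"
proof -
  let ?K = "a_kernel M M f"
  let ?N = "W1 <+>\<^bsub>M\<^esub> ?K"
  interpret W: left_module R "M\<lparr>carrier := W\<rparr>" by (rule left_module_submodule[OF W])
  interpret EW: ring "module_End R (M\<lparr>carrier := W\<rparr>)" by (rule W.ring_End)
  let ?EW = "module_End R (M\<lparr>carrier := W\<rparr>)"
  let ?E2 = "{\<alpha> \<in> carrier ?EW. \<alpha> ` ?N \<subseteq> ?N \<and> \<alpha> ` f ` W \<subseteq> f ` W}"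
  let ?T = "Cen0 R (M\<lparr>carrier := W\<rparr>) (restrict f W)"
  have fR: "restrict f W \<in> carrier ?EW"
    by (rule restrict_End[OF f W fW])
  have K: "submodule ?K R M"
    unfolding a_kernel_eq by (rule preimage_submodule[OF f submodule_carrier submodule_zero])
  have N: "submodule ?N R M" "?N \<subseteq> W" "?K \<subseteq> ?N"
    using submodule_sum[OF W1(1) K] sum_least[OF W W1(2) ker] sum_upper2[OF W1(1) K] by auto
  have W2: "submodule (f ` W) R M" by (rule image_submodule[OF f W])
  have "?E2 = {\<alpha> \<in> carrier ?EW. \<alpha> ` ?N \<subseteq> ?N} \<inter> {\<alpha> \<in> carrier ?EW. \<alpha> ` f ` W \<subseteq> f ` W}" by blast
  then have sub: "subring ?E2 ?EW"
    using N W2 fW submodule_of_submodule_iff[OF W]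
      EW.subring_inter[OF W.stabilizer_subring[of ?N] W.stabilizer_subring[of "f ` W"]] by simp
  have TK: "\<theta> x \<in> ?K" if "\<theta> \<in> ?T" "x \<in> W" for \<theta> x
    using Cen0_restrict_into_kernel[OF f W fW that] .
  have T2: "?T \<subseteq> ?E2"
  proof
    fix \<theta> assume \<theta>: "\<theta> \<in> ?T"
    then have "\<theta> \<in> carrier ?EW" "\<theta> ` f ` W \<subseteq> {\<zero>\<^bsub>M\<^esub>}" unfolding W.Cen0_iff[OF fR] by auto
    moreover from this(2) have "\<theta> ` f ` W \<subseteq> f ` W"
      using submoduleD(2)[OF W2] by (metis order_trans empty_subsetI insert_subset)
    moreover have "\<theta> ` ?N \<subseteq> ?N" using TK[OF \<theta>] N by blast
    ultimately show "\<theta> \<in> ?E2" by simp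
  qed
  have "\<theta> \<otimes>\<^bsub>?EW\<^esub> \<alpha> \<in> ?T" if "\<theta> \<in> ?T" "\<alpha> \<in> ?E2" for \<alpha> \<theta>
  proof -
    have \<theta>: "\<theta> \<in> carrier ?EW" "\<And>x. x \<in> W \<Longrightarrow> \<theta> (f x) = \<zero>\<^bsub>M\<^esub>"
      using that(1) unfolding W.Cen0_iff[OF fR] by auto
    have \<alpha>: "\<alpha> \<in> carrier ?EW" "\<And>x. x \<in> W \<Longrightarrow> \<alpha> x \<in> W" "\<And>x. x \<in> W \<Longrightarrow> \<alpha> (f x) \<in> f ` W"
      using that(2) W.EndD(1)[of \<alpha>] by auto
    have "\<theta> (\<alpha> (f x)) = \<zero>\<^bsub>M\<^esub>" if "x \<in> W" for x
      using \<alpha>(3)[OF that] \<theta>(2) by auto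
    moreover have "f (\<theta> (\<alpha> x)) = \<zero>\<^bsub>M\<^esub>" "\<theta> (\<alpha> x) \<in> W" if "x \<in> W" for x
      using TK[OF \<open>\<theta> \<in> ?T\<close> \<alpha>(2)[OF that]] ker by (auto simp: a_kernel_def')
    ultimately show ?thesis
      using W.End_mult_closed[OF \<theta>(1) \<alpha>(1)] fW
      unfolding W.Cen0_iff[OF fR] by (auto simp: W.End_mult image_subset_iff)
  qed
  then show ?thesis
    using EW.additive_subgroup_of_subset[OF W.Cen0_additive_subgroup[OF fR] _ T2] subring.axioms(1)[OF sub]
      EW.subring_is_ring[OF sub]
    by (intro right_ideal.intro right_ideal_axioms.intro) (auto simp: additive_subgroup_def)
qed

end

theorem theorem4p1:
  fixes R :: "('r, 'p) ring_scheme"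
    and M :: "('r, 'm, 'q) module_scheme"
    and \<phi> :: "'m \<Rightarrow> 'm"
  assumes "left_module R M"
    and "finitely_generated_module R M"
    and "semisimple_module R M"
    and "\<phi> \<in> carrier (module_End R M)"
  shows "\<exists>W1 W2 V W.
    direct_sum_of R M W W1 W2 \<and>
    direct_sum_of R M (carrier M) V W \<and>
    a_kernel M M \<phi> \<subseteq> W \<and>
    \<phi> ` W = W2 \<and>
    \<phi> ` V = V \<and>
    semisimple_dim R (M\<lparr>carrier := W1\<rparr>) = semisimple_dim R (M\<lparr>carrier := a_kernel M M \<phi>\<rparr>) \<and>
    (let E = module_End R (M\<lparr>carrier := W\<rparr>);
         K = a_kernel M M \<phi>;
         \<phi>W = restrict \<phi> W;
         T = {\<theta> \<in> carrier E. \<theta> ` W1 \<subseteq> K \<and> \<theta> ` W2 = {\<zero>\<^bsub>M\<^esub>}};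
         E1 = {\<alpha> \<in> carrier E. \<alpha> ` K \<subseteq> K};
         E2 = {\<alpha> \<in> carrier E. \<alpha> ` (W1 <+>\<^bsub>M\<^esub> K) \<subseteq> W1 <+>\<^bsub>M\<^esub> K \<and> \<alpha> ` W2 \<subseteq> W2}
     in \<phi>W \<in> carrier E \<and>
        (\<exists>k::nat. \<phi>W [^]\<^bsub>E\<^esub> k = \<zero>\<^bsub>E\<^esub>) \<and>
        nonunital_ring_isomorphic
          ((module_End R M)\<lparr>carrier := Cen0 R M \<phi>\<rparr>) (E\<lparr>carrier := T\<rparr>) \<and>
        T = Cen0 R (M\<lparr>carrier := W\<rparr>) \<phi>W \<and>
        left_ideal T (E\<lparr>carrier := E1\<rparr>) \<and>
        right_ideal T (E\<lparr>carrier := E2\<rparr>))"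
proof -
  interpret fg_semisimple_module R M
    using assms by (simp add: fg_semisimple_module_def fg_semisimple_module_axioms_def)
  note f = assms(4)
  obtain V W n where sum: "direct_sum_of R M (carrier M) V W" and fV: "\<phi> ` V = V"
    and W_eq: "W = {x \<in> carrier M. (\<phi> ^^ Suc n) x = \<zero>\<^bsub>M\<^esub>}"
    using fitting_decomposition[OF f] by blast
  have W: "submodule W R M" using sum unfolding direct_sum_of_def by blast
  have ker: "a_kernel M M \<phi> \<subseteq> W"
  proof
    fix x assume "x \<in> a_kernel M M \<phi>"
    moreover have "(\<phi> ^^ n) \<zero>\<^bsub>M\<^esub> = \<zero>\<^bsub>M\<^esub>" by (induction n) (simp_all add: End_apply_zero[OF f])
    ultimately show "x \<in> W" by (simp add: W_eq a_kernel_def' funpow_swap1)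
  qed
  have fW: "\<phi> ` W \<subseteq> W"
  proof
    fix y assume "y \<in> \<phi> ` W"
    then obtain x where x: "x \<in> carrier M" "(\<phi> ^^ Suc n) x = \<zero>\<^bsub>M\<^esub>" "y = \<phi> x"
      unfolding W_eq by blast
    have "(\<phi> ^^ Suc n) y = \<phi> ((\<phi> ^^ Suc n) x)"
      unfolding x(3) by (rule funpow_swap1 [symmetric])
    then show "y \<in> W"
      using x EndD(1)[OF f] End_apply_zero[OF f] unfolding W_eq by simp
  qed
  have W2: "submodule (\<phi> ` W) R M" by (rule image_submodule[OF f W])
  obtain W1 where W1: "submodule W1 R M" "(\<phi> ` W) <+>\<^bsub>M\<^esub> W1 = W" "(\<phi> ` W) \<inter> W1 = {\<zero>\<^bsub>M\<^esub>}"
    using relative_complement_exists[OF W2 W fW] by blast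
  then have sumW: "direct_sum_of R M W W1 (\<phi> ` W)"
    using W2 sum_commute[OF W1(1) W2] unfolding direct_sum_of_def by (simp add: Int_commute)
  have W1W: "W1 \<subseteq> W" using sum_upper2[OF W2 W1(1)] W1(2) by simp
  interpret W: left_module R "M\<lparr>carrier := W\<rparr>" by (rule left_module_submodule[OF W])
  interpret EW: ring "module_End R (M\<lparr>carrier := W\<rparr>)" by (rule W.ring_End)
  have fR: "restrict \<phi> W \<in> carrier (module_End R (M\<lparr>carrier := W\<rparr>))"
    by (rule restrict_End[OF f W fW])
  have nil: "restrict \<phi> W [^]\<^bsub>module_End R (M\<lparr>carrier := W\<rparr>)\<^esub> Suc n =
      \<zero>\<^bsub>module_End R (M\<lparr>carrier := W\<rparr>)\<^esub>"
  proof (rule W.End_eqI)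
    show "restrict \<phi> W [^]\<^bsub>module_End R (M\<lparr>carrier := W\<rparr>)\<^esub> Suc n \<in>
        carrier (module_End R (M\<lparr>carrier := W\<rparr>))"
      using fR by (rule EW.nat_pow_closed)
    fix x assume "x \<in> carrier (M\<lparr>carrier := W\<rparr>)"
    then have "x \<in> W" "(\<phi> ^^ Suc n) x = \<zero>\<^bsub>M\<^esub>" using W_eq by auto
    then show "(restrict \<phi> W [^]\<^bsub>module_End R (M\<lparr>carrier := W\<rparr>)\<^esub> Suc n) x =
        \<zero>\<^bsub>module_End R (M\<lparr>carrier := W\<rparr>)\<^esub> x"
      using restrict_nat_pow[OF f W fW, of x "Suc n"] by (simp add: W.End_zero)
  qed (rule W.End_zero_closed)
  have T: "{\<theta> \<in> carrier (module_End R (M\<lparr>carrier := W\<rparr>)).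
       \<theta> ` W1 \<subseteq> a_kernel M M \<phi> \<and> \<theta> ` \<phi> ` W = {\<zero>\<^bsub>M\<^esub>}} = Cen0 R (M\<lparr>carrier := W\<rparr>) (restrict \<phi> W)"
    using Cen0_restrict_eq[OF f W ker sumW] by simp
  have dim: "semisimple_dim R (M\<lparr>carrier := W1\<rparr>) = semisimple_dim R (M\<lparr>carrier := a_kernel M M \<phi>\<rparr>)"
    by (rule semisimple_dim_complement_of_image[OF f W ker sumW])
  show ?thesis
    apply (rule exI[of _ W1], rule exI[of _ "\<phi> ` W"], rule exI[of _ V], rule exI[of _ W])
    unfolding Let_def T
    using sumW sum ker fV dim fR nil Cen0_restrict_isomorphic[OF f sum fV fW ker]
      Cen0_restrict_left_ideal[OF f W ker fW] Cen0_restrict_right_ideal[OF f W ker W1(1) W1W fW]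
    by blast
qed

end
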